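(* Let $f:\mathbb{R}^{m\times n}\to\mathbb{R}$ be convex and continuously differentiable, let $R>0$, and consider the problem $\min_{\mathbf{X}\in\mathbb{R}^{m\times n}:\ \|\mathbf{X}\|_1\le R}f(\mathbf{X})$, where $\|\cdot\|_1$ is the nuclear norm. Let $\beta_1$ be the Lipschitz constant of $\nabla f$ over the feasible set w.r.t. the nuclear norm, and let $\alpha_2>0$ be the quadratic growth constant w.r.t. the Frobenius norm (both defined in the context). Assume that any optimal solution $\mathbf{X}^*$ satisfies $\mathrm{rank}(\mathbf{X}^* )\le s\ll\min\{m,n\}$ (for a positive integer $s$) and $\|\mathbf{X}^*\|_1=R$, and that the step-size parameter $\eta=\frac{\alpha_2}{64\beta_1 s}$ lies in $[0,1]$. Then the algorithm described in the context admits an implementation that finds an $\epsilon$-approximated solution (in function value) in $O\left(\frac{\beta_1 s}{\alpha_2}\log\frac{1}{\epsilon}\right)$ iterations, and, aside from the gradient computations, the runtime of each iteration is dominated by two rank-$s$ SVDs of $m\times n$ matrices.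
   Context: $\|\mathbf{X}\|_1$ is the nuclear norm (sum of singular values), $\|\mathbf{X}\|_{\mathrm{op}}$ the largest singular value (the dual norm), $\|\mathbf{X}\|_2$ the Euclidean (Frobenius) norm and $\langle\cdot,\cdot\rangle$ the corresponding trace inner product. $\mathcal{K}=\{\mathbf{X}\in\mathbb{R}^{m\times n}:\|\mathbf{X}\|_1\le R\}$, $f^*$ is the optimal value, $\mathcal{X}^*$ is the set of minimizers over $\mathcal{K}$. The constant $\beta_1>0$ satisfies $\|\nabla f(\mathbf{X})-\nabla f(\mathbf{Y})\|_{\mathrm{op}}\le\beta_1\|\mathbf{X}-\mathbf{Y}\|_1$ for all $\mathbf{X},\mathbf{Y}\in\mathcal{K}$. The constant $\alpha_2>0$ satisfies $\min_{\mathbf{X}^*\in\mathcal{X}^*}\|\mathbf{X}-\mathbf{X}^*\|_2^2\le\frac{2}{\alpha_2}(f(\mathbf{X})-f^* )$ for all $\mathbf{X}\in\mathcal{K}$. A feasible $\mathbf{X}$ is an $\epsilon$-approximated solution (in function value) if $f(\mathbf{X})-f^*\le\epsilon$. In the iteration bound, $O(\cdot)$ hides universal constants and the dependence of the logarithm on the initial error $f(\mathbf{X}_1)-f^*$. A rank-$s$ SVD of a matrix means computing the $s$ leading components (largest singular values with corresponding singular vectors) of its SVD. Algorithm. Let $\mathbb{E}_s=\{\mathbf{X}\in\mathbb{R}^{m\times n}:\mathrm{rank}(\mathbf{X})\le s\}$ and $\mathcal{K}_s=\mathcal{K}\cap\mathbb{E}_s$. Start from some $\mathbf{X}_1\in\mathcal{K}$.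 With step-size parameter $\eta=\frac{\alpha_2}{64\beta_1 s}$, for $t=1,2,\dots$: - $\widehat{\mathbf{X}}_t\gets$ a Euclidean projection of $\mathbf{X}_t$ onto $\mathbb{E}_s$ (best rank-$s$ approximation); - $\mathbf{V}_t\gets$ an element of $\arg\min_{\mathbf{V}\in\mathcal{K}_s}\langle\mathbf{V}-\mathbf{X}_t,\nabla f(\mathbf{X}_t)\rangle+2s\beta_1\eta\|\mathbf{V}-\widehat{\mathbf{X}}_t\|_2^2$, equivalently a Euclidean projection of $\widehat{\mathbf{X}}_t-\frac{1}{4s\beta_1\eta}\nabla f(\mathbf{X}_t)$ onto $\mathcal{K}_s$; - $\gamma_t\in[0,1]$ is set either by line-search, $\gamma_t\in\arg\min_{\gamma\in[0,1]}f((1-\gamma)\mathbf{X}_t+\gamma\mathbf{V}_t)$, or to the pre-defined value $\gamma_t=\eta$; - $\mathbf{X}_{t+1}\gets(1-\gamma_t)\mathbf{X}_t+\gamma_t\mathbf{V}_t$. *)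

theory Defs
  imports "HOL-Analysis.Analysis"
begin

section \<open>Singular values and matrix norms\<close>

text \<open>
  Matrices are elements of \<open>real^'n^'m\<close>, with \<open>m = CARD('m)\<close> rows and \<open>n = CARD('n)\<close> columns. The
  library instances of \<open>norm\<close>, \<open>dist\<close> and \<open>inner\<close> on this type are the Frobenius norm, its distance
  and the trace inner product.
\<close>

definition outer_prod :: "real^'m \<Rightarrow> real^'n \<Rightarrow> real^'n^'m" where
  "outer_prod u v = (\<chi> i j. u $ i * v $ j)"

definition num_sv :: "(real^'n^'m) itself \<Rightarrow> nat" where
  "num_sv _ = min CARD('m) CARD('n)"

text \<open>
  Thin singular value decomposition; only the indices below \<open>min m n\<close> matter, and the singular
  values are listed in decreasing order.
\<close>

definition is_svd ::
  "real^'n^'m \<Rightarrow> (nat \<Rightarrow> real) \<Rightarrow> (nat \<Rightarrow> real^'m) \<Rightarrow> (nat \<Rightarrow> real^'n) \<Rightarrow> bool" where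
  "is_svd M \<sigma> u v \<longleftrightarrow>
     (let r = num_sv TYPE(real^'n^'m) in
       (\<forall>k<r. \<forall>l<r. u k \<bullet> u l = (if k = l then 1 else 0)) \<and>
       (\<forall>k<r. \<forall>l<r. v k \<bullet> v l = (if k = l then 1 else 0)) \<and>
       (\<forall>k<r. 0 \<le> \<sigma> k) \<and>
       (\<forall>k l. k \<le> l \<and> l < r \<longrightarrow> \<sigma> l \<le> \<sigma> k) \<and>
       M = (\<Sum>k<r. \<sigma> k *\<^sub>R outer_prod (u k) (v k)))"

text \<open>
  The singular vectors of a matrix are not unique, but the singular values are, so that the definite
  description below is meaningful for \<open>k < min m n\<close>.
\<close>

definition singular_value :: "real^'n^'m \<Rightarrow> nat \<Rightarrow> real" where
  "singular_value M k = (THE x. \<exists>\<sigma> u v. is_svd M \<sigma> u v \<and> x = \<sigma> k)"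

definition nuclear_norm :: "real^'n^'m \<Rightarrow> real" where
  "nuclear_norm M = (\<Sum>k<num_sv TYPE(real^'n^'m). singular_value M k)"

definition op_norm :: "real^'n^'m \<Rightarrow> real" where
  "op_norm M = Max (singular_value M ` {..<num_sv TYPE(real^'n^'m)})"

definition is_leading_svd ::
  "nat \<Rightarrow> real^'n^'m \<Rightarrow> (nat \<Rightarrow> real) \<times> (nat \<Rightarrow> real^'m) \<times> (nat \<Rightarrow> real^'n) \<Rightarrow> bool" where
  "is_leading_svd s M = (\<lambda>(\<sigma>, u, v). \<exists>\<sigma>' u' v'. is_svd M \<sigma>' u' v' \<and>
     (\<forall>l<s. \<sigma> l = \<sigma>' l \<and> u l = u' l \<and> v l = v' l))"


section \<open>The optimization problem\<close>

definition nuclear_ball :: "real \<Rightarrow> (real^'n^'m) set" where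
  "nuclear_ball R = {X. nuclear_norm X \<le> R}"

definition opt_value :: "(real^'n^'m \<Rightarrow> real) \<Rightarrow> real \<Rightarrow> real" where
  "opt_value f R = (INF X\<in>nuclear_ball R. f X)"

definition minimizers :: "(real^'n^'m \<Rightarrow> real) \<Rightarrow> real \<Rightarrow> (real^'n^'m) set" where
  "minimizers f R = {X. is_arg_min f (\<lambda>Y. Y \<in> nuclear_ball R) X}"

definition approx_solution ::
  "(real^'n^'m \<Rightarrow> real) \<Rightarrow> real \<Rightarrow> real \<Rightarrow> real^'n^'m \<Rightarrow> bool" where
  "approx_solution f R \<epsilon> X \<longleftrightarrow> X \<in> nuclear_ball R \<and> f X - opt_value f R \<le> \<epsilon>"

definition nuclear_lipschitz :: "(real^'n^'m \<Rightarrow> real^'n^'m) \<Rightarrow> real \<Rightarrow> real \<Rightarrow> bool" where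
  "nuclear_lipschitz g R \<beta>1 \<longleftrightarrow>
     (\<forall>X\<in>nuclear_ball R. \<forall>Y\<in>nuclear_ball R. op_norm (g X - g Y) \<le> \<beta>1 * nuclear_norm (X - Y))"

text \<open>The set of minimizers is nonempty and compact, so that the infimum below is a minimum.\<close>

definition quadratic_growth :: "(real^'n^'m \<Rightarrow> real) \<Rightarrow> real \<Rightarrow> real \<Rightarrow> bool" where
  "quadratic_growth f R \<alpha>2 \<longleftrightarrow>
     (\<forall>X\<in>nuclear_ball R.
        (INF Xs\<in>minimizers f R. (norm (X - Xs))\<^sup>2) \<le> 2 / \<alpha>2 * (f X - opt_value f R))"


section \<open>The algorithm\<close>

datatype step_rule = Line_Search | Predefined

definition step_param :: "nat \<Rightarrow> real \<Rightarrow> real \<Rightarrow> real" where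
  "step_param s \<beta>1 \<alpha>2 = \<alpha>2 / (64 * \<beta>1 * real s)"

definition fw_step ::
  "(real^'n^'m \<Rightarrow> real) \<Rightarrow> (real^'n^'m \<Rightarrow> real^'n^'m) \<Rightarrow> real \<Rightarrow> nat \<Rightarrow> real \<Rightarrow> real \<Rightarrow>
   step_rule \<Rightarrow> real^'n^'m \<Rightarrow> real^'n^'m \<Rightarrow> bool" where
  "fw_step f g R s \<beta>1 \<eta> rule X X' \<longleftrightarrow>
     (\<exists>Xh V \<gamma>.
        is_arg_min (\<lambda>Z. dist X Z) (\<lambda>Z. rank Z \<le> s) Xh \<and>
        is_arg_min (\<lambda>W. (W - X) \<bullet> g X + 2 * real s * \<beta>1 * \<eta> * (norm (W - Xh))\<^sup>2)
          (\<lambda>W. W \<in> nuclear_ball R \<and> rank W \<le> s) V \<and>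
        (case rule of
           Line_Search \<Rightarrow>
             is_arg_min (\<lambda>\<delta>. f ((1 - \<delta>) *\<^sub>R X + \<delta> *\<^sub>R V)) (\<lambda>\<delta>. \<delta> \<in> {0..1}) \<gamma>
         | Predefined \<Rightarrow> \<gamma> = \<eta>) \<and>
        X' = (1 - \<gamma>) *\<^sub>R X + \<gamma> *\<^sub>R V)"

text \<open>Iterates are numbered from 1; the step-size rule may be chosen anew in every iteration.\<close>

definition fw_run ::
  "(real^'n^'m \<Rightarrow> real) \<Rightarrow> (real^'n^'m \<Rightarrow> real^'n^'m) \<Rightarrow> real \<Rightarrow> nat \<Rightarrow> real \<Rightarrow> real \<Rightarrow>
   (nat \<Rightarrow> step_rule) \<Rightarrow> (nat \<Rightarrow> real^'n^'m) \<Rightarrow> bool" where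
  "fw_run f g R s \<beta>1 \<alpha>2 rule X \<longleftrightarrow>
     X 1 \<in> nuclear_ball R \<and>
     (\<forall>t\<ge>1. fw_step f g R s \<beta>1 (step_param s \<beta>1 \<alpha>2) (rule t) (X t) (X (t + 1)))"


section \<open>Machine model\<close>

text \<open>
  Implementations are loop-free branching programs over real-valued memory cells (algebraic
  computation trees), where a loop whose length is fixed by \<open>m\<close>, \<open>n\<close> and \<open>s\<close> is unrolled. Besides
  operations on single cells, a program may call three subroutines: a rank-\<open>s\<close> SVD, the gradient,
  and exact line search. The cell \<open>Entry k i j\<close> is the \<open>(i, j)\<close> entry of the matrix register \<open>k\<close>;
  \<open>Sval l\<close>, \<open>Left l i\<close> and \<open>Right l j\<close> hold the components computed by an SVD call; \<open>Scalar\<close>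
  cells are for any use.
\<close>

datatype ('m, 'n) cell =
    Entry nat 'm 'n
  | Sval nat
  | Left nat 'm
  | Right nat 'n
  | Scalar nat

type_synonym ('m, 'n) memory = "('m, 'n) cell \<Rightarrow> real"

datatype arith_op = Plus | Minus | Times | Divide

primrec apply_op :: "arith_op \<Rightarrow> real \<Rightarrow> real \<Rightarrow> real" where
  "apply_op Plus x y = x + y"
| "apply_op Minus x y = x - y"
| "apply_op Times x y = x * y"
| "apply_op Divide x y = x / y"

text \<open>
  The first argument of an instruction is its destination, except that \<open>Svd\<close> has only the number of
  its argument register. \<open>Line d a b\<close> stores in \<open>Scalar d\<close> a step from register \<open>a\<close> towards
  register \<open>b\<close>.
\<close>

datatype ('m, 'n) instr =
    Const "('m, 'n) cell" real
  | Copy "('m, 'n) cell" "('m, 'n) cell"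
  | Calc "('m, 'n) cell" arith_op "('m, 'n) cell" "('m, 'n) cell"
  | Svd nat
  | Grad nat nat
  | Line nat nat nat

datatype ('m, 'n) prog =
    Skip
  | Do "('m, 'n) instr"
  | Seq "('m, 'n) prog" "('m, 'n) prog"
  | If_le "('m, 'n) cell" "('m, 'n) cell" "('m, 'n) prog" "('m, 'n) prog"

definition matrix_at :: "('m::finite, 'n::finite) memory \<Rightarrow> nat \<Rightarrow> real^'n^'m" where
  "matrix_at \<mu> k = (\<chi> i j. \<mu> (Entry k i j))"

definition store_svd ::
  "nat \<Rightarrow> (nat \<Rightarrow> real) \<times> (nat \<Rightarrow> real^'m) \<times> (nat \<Rightarrow> real^'n) \<Rightarrow>
   ('m, 'n) memory \<Rightarrow> ('m, 'n) memory" where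
  "store_svd s = (\<lambda>(\<sigma>, u, v) \<mu> c.
     (case c of
        Sval l \<Rightarrow> if l < s then \<sigma> l else \<mu> c
      | Left l i \<Rightarrow> if l < s then u l $ i else \<mu> c
      | Right l j \<Rightarrow> if l < s then v l $ j else \<mu> c
      | _ \<Rightarrow> \<mu> c))"

definition store_matrix ::
  "nat \<Rightarrow> real^'n^'m \<Rightarrow> ('m, 'n) memory \<Rightarrow> ('m, 'n) memory" where
  "store_matrix k M = (\<lambda>\<mu> c.
     (case c of Entry k' i j \<Rightarrow> if k' = k then M $ i $ j else \<mu> c | _ \<Rightarrow> \<mu> c))"

record ('m, 'n) subroutines =
  svd_sub :: "real^'n^'m \<Rightarrow> (nat \<Rightarrow> real) \<times> (nat \<Rightarrow> real^'m) \<times> (nat \<Rightarrow> real^'n)"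
  grad_sub :: "real^'n^'m \<Rightarrow> real^'n^'m"
  line_sub :: "real^'n^'m \<Rightarrow> real^'n^'m \<Rightarrow> real"

definition correct_subroutines ::
  "(real^'n^'m \<Rightarrow> real) \<Rightarrow> (real^'n^'m \<Rightarrow> real^'n^'m) \<Rightarrow> nat \<Rightarrow>
   ('m::finite, 'n::finite) subroutines \<Rightarrow> bool" where
  "correct_subroutines f g s S \<longleftrightarrow>
     (\<forall>M. is_leading_svd s M (svd_sub S M)) \<and>
     (\<forall>M. grad_sub S M = g M) \<and>
     (\<forall>A B. is_arg_min (\<lambda>\<delta>. f ((1 - \<delta>) *\<^sub>R A + \<delta> *\<^sub>R B)) (\<lambda>\<delta>. \<delta> \<in> {0..1}) (line_sub S A B))"

primrec exec_instr ::
  "nat \<Rightarrow> ('m::finite, 'n::finite) subroutines \<Rightarrow> ('m, 'n) instr \<Rightarrow>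
   ('m, 'n) memory \<Rightarrow> ('m, 'n) memory" where
  "exec_instr s S (Const d x) \<mu> = \<mu>(d := x)"
| "exec_instr s S (Copy d a) \<mu> = \<mu>(d := \<mu> a)"
| "exec_instr s S (Calc d p a b) \<mu> = \<mu>(d := apply_op p (\<mu> a) (\<mu> b))"
| "exec_instr s S (Svd k) \<mu> = store_svd s (svd_sub S (matrix_at \<mu> k)) \<mu>"
| "exec_instr s S (Grad d k) \<mu> = store_matrix d (grad_sub S (matrix_at \<mu> k)) \<mu>"
| "exec_instr s S (Line d a b) \<mu> = \<mu>(Scalar d := line_sub S (matrix_at \<mu> a) (matrix_at \<mu> b))"

primrec exec ::
  "nat \<Rightarrow> ('m::finite, 'n::finite) subroutines \<Rightarrow> ('m, 'n) prog \<Rightarrow>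
   ('m, 'n) memory \<Rightarrow> ('m, 'n) memory" where
  "exec s S Skip \<mu> = \<mu>"
| "exec s S (Do i) \<mu> = exec_instr s S i \<mu>"
| "exec s S (Seq p q) \<mu> = exec s S q (exec s S p \<mu>)"
| "exec s S (If_le a b p q) \<mu> = (if \<mu> a \<le> \<mu> b then exec s S p \<mu> else exec s S q \<mu>)"

datatype resource = Elementary | Svd_Call | Grad_Call | Line_Call

primrec resource_of :: "('m, 'n) instr \<Rightarrow> resource" where
  "resource_of (Const d x) = Elementary"
| "resource_of (Copy d a) = Elementary"
| "resource_of (Calc d p a b) = Elementary"
| "resource_of (Svd k) = Svd_Call"
| "resource_of (Grad d k) = Grad_Call"
| "resource_of (Line d a b) = Line_Call"

primrec cost ::
  "nat \<Rightarrow> ('m::finite, 'n::finite) subroutines \<Rightarrow> ('m, 'n) prog \<Rightarrow>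
   ('m, 'n) memory \<Rightarrow> resource \<Rightarrow> nat" where
  "cost s S Skip \<mu> r = 0"
| "cost s S (Do i) \<mu> r = (if r = resource_of i then 1 else 0)"
| "cost s S (Seq p q) \<mu> r = cost s S p \<mu> r + cost s S q (exec s S p \<mu>) r"
| "cost s S (If_le a b p q) \<mu> r =
     (if r = Elementary then 1 else 0) +
     (if \<mu> a \<le> \<mu> b then cost s S p \<mu> r else cost s S q \<mu> r)"

text \<open>
  The program \<open>P rule\<close> carries out one iteration with the given step-size rule. Initially, \<open>X\<^sub>1\<close> is
  in the matrix register 0 and the parameters are in the first three scalar cells; the remaining
  memory is arbitrary. Afterwards the memory is changed by the program only.
\<close>

definition initial_memory ::
  "real \<Rightarrow> real \<Rightarrow> real \<Rightarrow> real^'n^'m \<Rightarrow> ('m::finite, 'n::finite) memory \<Rightarrow> bool" where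
  "initial_memory R \<beta>1 \<alpha>2 X1 \<mu> \<longleftrightarrow>
     matrix_at \<mu> 0 = X1 \<and> \<mu> (Scalar 0) = R \<and> \<mu> (Scalar 1) = \<beta>1 \<and> \<mu> (Scalar 2) = \<alpha>2"

definition machine_run ::
  "(step_rule \<Rightarrow> ('m::finite, 'n::finite) prog) \<Rightarrow> nat \<Rightarrow> ('m, 'n) subroutines \<Rightarrow>
   (nat \<Rightarrow> step_rule) \<Rightarrow> (nat \<Rightarrow> ('m, 'n) memory) \<Rightarrow> bool" where
  "machine_run P s S rule mem \<longleftrightarrow> (\<forall>t\<ge>1. mem (t + 1) = exec s S (P (rule t)) (mem t))"

text \<open>
  Two rank-\<open>s\<close> SVD calls dominate the iteration: apart from them (and from one gradient and at most
  one line search) only \<open>O(s m n)\<close> elementary operations are executed, which is the order of \<open>s\<close>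
  matrix-vector products and hence of a single rank-\<open>s\<close> SVD. The factor is an explicit number
  because it must not depend on \<open>m\<close> and \<open>n\<close>, which are not quantifiable inside a formula.
\<close>

definition dominated_by_two_svds ::
  "nat \<Rightarrow> ('m::finite, 'n::finite) subroutines \<Rightarrow> step_rule \<Rightarrow> ('m, 'n) prog \<Rightarrow>
   ('m, 'n) memory \<Rightarrow> bool" where
  "dominated_by_two_svds s S rule p \<mu> \<longleftrightarrow>
     cost s S p \<mu> Svd_Call \<le> 2 \<and>
     cost s S p \<mu> Elementary \<le> 100 * (s * CARD('m) * CARD('n)) \<and>
     cost s S p \<mu> Grad_Call \<le> 1 \<and>
     cost s S p \<mu> Line_Call \<le> (case rule of Line_Search \<Rightarrow> 1 | Predefined \<Rightarrow> 0)"

text \<open>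
  After \<open>k\<close> iterations, that is at \<open>X\<^sub>k\<^sub>+\<^sub>1\<close>, accuracy \<open>\<epsilon>\<close> is reached as soon as \<open>k\<close> is at least
  \<open>128 \<beta>1 s / \<alpha>2 * ln ((f X\<^sub>1 - f\<^sup>*) / \<epsilon>)\<close>. The universal constant is again an explicit number.
\<close>

definition linear_iteration_bound ::
  "(real^'n^'m \<Rightarrow> real) \<Rightarrow> real \<Rightarrow> nat \<Rightarrow> real \<Rightarrow> real \<Rightarrow> (nat \<Rightarrow> real^'n^'m) \<Rightarrow> bool" where
  "linear_iteration_bound f R s \<beta>1 \<alpha>2 X \<longleftrightarrow>
     (\<forall>\<epsilon>>0. \<forall>k::nat.
        128 * (\<beta>1 * real s / \<alpha>2) * ln ((f (X 1) - opt_value f R) / \<epsilon>) \<le> real k \<longrightarrow>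
        approx_solution f R \<epsilon> (X (k + 1)))"

end

theory Submission
  imports Defs
begin

text \<open>
  Write \<open>E\<close> for the residual of the best rank-\<open>s\<close> approximation \<open>Z\<close> of an iterate \<open>X\<close>. It is orthogonal to
  \<open>Z\<close> in both row and column space, so the nuclear norm is additive on \<open>X = Z + E\<close>; as \<open>X\<close> has norm
  at most \<open>R\<close> and a minimizer \<open>X\<^sub>*\<close> has norm \<open>R\<close> and rank at most \<open>s\<close>, the nuclear norm of \<open>E\<close> is at
  most that of \<open>X\<^sub>* - Z\<close>, hence \<open>O(\<surd>s)\<close> times the Frobenius distance of \<open>X\<close> and \<open>X\<^sub>*\<close>. Together with
  \<open>rank (V - Z) \<le> 2 s\<close> this bounds the quadratic term of the nuclear-norm descent inequality, and
  quadratic growth turns the remainder into half of the gain \<open>\<eta> (f X - f\<^sub>*)\<close>: every step contracts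
  the error by \<open>1 - \<eta> / 2\<close>. For the implementation, von Neumann's trace inequality reduces both
  projections to the vector of the \<open>s\<close> leading singular values, which is truncated in the first case and
  soft-thresholded in the second.
\<close>

section \<open>Orthonormal families and outer products\<close>

text \<open>The obstacle is a mismatch of norms: smoothness is measured in the nuclear norm, growth
  in the Frobenius norm, and passing from one to the other costs the rank. An iterate mixes all
  earlier \<open>V\<close>, so \<open>V - X\<close> can have full rank; the detour through the
  truncation confines the conversion to differences of low-rank matrices. This is why the subproblem
  penalises the distance to the truncation and not to \<open>X\<close>: its weight is the one that
  cancels the \<open>V\<close>-dependent part of the descent inequality. Since
  \<open>nuclear_norm\<close> is defined from singular values, even its triangle inequality has to
  be earned. A decomposition is built by successive maximisation, and Ky Fan's principle then
  describes sums of singular values without reference to a particular decomposition. The program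
  must work with whichever singular vectors a subroutine returns, so both projections are
  established for an arbitrary decomposition, ties included.\<close>

declare transpose_matrix_vector [simp del]

text \<open>The index type is arbitrary because families are later glued over a disjoint union. The
  vector type is arbitrary because outer products of singular vectors form such a family in the
  matrix space.\<close>

definition orthonormal_on :: "'i set \<Rightarrow> ('i \<Rightarrow> 'a::real_inner) \<Rightarrow> bool" where
  "orthonormal_on I u \<longleftrightarrow> (\<forall>i\<in>I. \<forall>j\<in>I. u i \<bullet> u j = (if i = j then 1 else 0))"

lemma orthonormal_onD:
  "orthonormal_on I u \<Longrightarrow> i \<in> I \<Longrightarrow> j \<in> I \<Longrightarrow> u i \<bullet> u j = (if i = j then 1 else 0)"
  by (auto simp: orthonormal_on_def)

lemma orthonormal_on_subset: "orthonormal_on I u \<Longrightarrow> J \<subseteq> I \<Longrightarrow> orthonormal_on J u"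
  unfolding orthonormal_on_def by blast

lemma orthonormal_on_norm:
  "orthonormal_on I u \<Longrightarrow> i \<in> I \<Longrightarrow> norm (u i) = 1"
  by (simp add: norm_eq_1 orthonormal_onD)

lemma orthonormal_on_norm_sum:
  assumes "finite I" "orthonormal_on I u"
  shows "(norm (\<Sum>i\<in>I. c i *\<^sub>R u i))\<^sup>2 = (\<Sum>i\<in>I. (c i)\<^sup>2)"
proof -
  have "(norm (\<Sum>i\<in>I. c i *\<^sub>R u i))\<^sup>2 = (\<Sum>i\<in>I. \<Sum>j\<in>I. c i * (c j * (u i \<bullet> u j)))"
    by (simp add: power2_norm_eq_inner inner_sum_left inner_sum_right sum_distrib_left)
       (simp add: inner_commute)
  also have "\<dots> = (\<Sum>i\<in>I. (c i)\<^sup>2)"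
  proof (rule sum.cong[OF refl])
    fix i assume i: "i \<in> I"
    have "(\<Sum>j\<in>I. c i * (c j * (u i \<bullet> u j))) = (\<Sum>j\<in>I. if i = j then c i * c j else 0)"
      by (rule sum.cong) (auto simp: orthonormal_onD[OF assms(2) i])
    then show "(\<Sum>j\<in>I. c i * (c j * (u i \<bullet> u j))) = (c i)\<^sup>2"
      using i assms(1) by (simp add: power2_eq_square)
  qed
  finally show ?thesis .
qed

lemma bessel:
  assumes "finite I" "orthonormal_on I u"
  shows "(\<Sum>i\<in>I. (u i \<bullet> x)\<^sup>2) \<le> (norm x)\<^sup>2"
proof -
  define p where "p = (\<Sum>i\<in>I. (u i \<bullet> x) *\<^sub>R u i)"
  have 1: "p \<bullet> p = (\<Sum>i\<in>I. (u i \<bullet> x)\<^sup>2)"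
    unfolding p_def power2_norm_eq_inner[symmetric] by (rule orthonormal_on_norm_sum[OF assms])
  have 2: "p \<bullet> x = (\<Sum>i\<in>I. (u i \<bullet> x)\<^sup>2)"
    by (simp add: p_def inner_sum_left power2_eq_square)
  have "0 \<le> (x - p) \<bullet> (x - p)" by simp
  also have "\<dots> = (norm x)\<^sup>2 - p \<bullet> x"
    by (simp add: inner_diff_left inner_diff_right power2_norm_eq_inner 1 2 inner_commute[of x p])
  finally show ?thesis by (simp add: 2)
qed

text \<open>Each product is at most the mean of the two squares, and Bessel bounds both sums of
  squares by 1.\<close>

lemma bessel_abs_product:
  assumes "finite I" "orthonormal_on I u" "orthonormal_on I v" "norm x \<le> 1" "norm y \<le> 1"
  shows "(\<Sum>i\<in>I. \<bar>u i \<bullet> x\<bar> * \<bar>v i \<bullet> y\<bar>) \<le> 1"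
proof -
  have "(\<Sum>i\<in>I. \<bar>u i \<bullet> x\<bar> * \<bar>v i \<bullet> y\<bar>) \<le> (\<Sum>i\<in>I. ((u i \<bullet> x)\<^sup>2 + (v i \<bullet> y)\<^sup>2) / 2)"
  proof (rule sum_mono)
    fix i
    show "\<bar>u i \<bullet> x\<bar> * \<bar>v i \<bullet> y\<bar> \<le> ((u i \<bullet> x)\<^sup>2 + (v i \<bullet> y)\<^sup>2) / 2"
      using sum_squares_bound[of "\<bar>u i \<bullet> x\<bar>" "\<bar>v i \<bullet> y\<bar>"] by simp
  qed
  also have "\<dots> = ((\<Sum>i\<in>I. (u i \<bullet> x)\<^sup>2) + (\<Sum>i\<in>I. (v i \<bullet> y)\<^sup>2)) / 2"
    by (simp add: sum.distrib sum_divide_distrib[symmetric])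
  also have "\<dots> \<le> 1"
    using bessel[OF assms(1,2), of x] bessel[OF assms(1,3), of y]
      power_le_one[OF _ assms(4), of 2] power_le_one[OF _ assms(5), of 2] by simp
  finally show ?thesis .
qed

lemma orthonormal_on_card:
  assumes "finite I" "orthonormal_on I u"
  shows "inj_on u I" and "independent (u ` I)"
proof -
  show "inj_on u I"
  proof (rule inj_onI)
    fix i j assume "i \<in> I" "j \<in> I" "u i = u j"
    then show "i = j"
      using orthonormal_onD[OF assms(2), of i j] orthonormal_onD[OF assms(2), of i i]
      by (auto split: if_splits)
  qed
  have "0 \<notin> u ` I" using orthonormal_on_norm[OF assms(2)] by force
  moreover have "pairwise orthogonal (u ` I)"
    using assms(2) by (auto simp: pairwise_def orthogonal_def orthonormal_on_def)
  ultimately show "independent (u ` I)"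
    by (rule pairwise_orthogonal_independent[rotated])
qed

lemma orthonormal_on_span:
  fixes u :: "'i \<Rightarrow> 'a::euclidean_space"
  assumes "finite I" "orthonormal_on I u" "card I = DIM('a)"
  shows "span (u ` I) = UNIV"
  using card_ge_dim_independent[OF subset_UNIV orthonormal_on_card(2)[OF assms(1,2)]]
    card_image[OF orthonormal_on_card(1)[OF assms(1,2)]] assms(3) by auto

lemma orthonormal_on_Plus:
  assumes "orthonormal_on I u" "orthonormal_on J w" "\<And>i j. i \<in> I \<Longrightarrow> j \<in> J \<Longrightarrow> u i \<bullet> w j = 0"
  shows "orthonormal_on (I <+> J) (case_sum u w)"
  unfolding orthonormal_on_def
proof (intro ballI)
  fix p q assume "p \<in> I <+> J" "q \<in> I <+> J"
  then show "case_sum u w p \<bullet> case_sum u w q = (if p = q then 1 else 0)"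
    by (elim PlusE) (simp_all add: assms(3) inner_commute[of "w _" "u _"]
        orthonormal_onD[OF assms(1)] orthonormal_onD[OF assms(2)])
qed

section \<open>Outer products, transposes and the trace inner product\<close>

lemma outer_prod_vector_mult: "outer_prod u v *v x = (v \<bullet> x) *\<^sub>R u"
  by (simp add: vec_eq_iff outer_prod_def matrix_vector_mult_def inner_vec_def sum_distrib_left
      sum_distrib_right mult_ac)

lemma transpose_outer_prod: "transpose (outer_prod u v) = outer_prod v u"
  by (simp add: vec_eq_iff outer_prod_def transpose_def mult.commute)

lemma inner_outer_prod_right: "W \<bullet> outer_prod u v = u \<bullet> (W *v v)"
  by (simp add: outer_prod_def matrix_vector_mult_def inner_vec_def sum_distrib_left mult_ac)

lemma inner_outer_prod_left: "outer_prod u v \<bullet> W = u \<bullet> (W *v v)"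
  by (simp add: inner_commute[of _ W] inner_outer_prod_right)

lemma inner_outer_prod_outer_prod: "outer_prod a b \<bullet> outer_prod u v = (a \<bullet> u) * (b \<bullet> v)"
  by (simp add: inner_outer_prod_left outer_prod_vector_mult inner_commute[of v b])

lemma inner_transpose_mult:
  fixes A :: "real^'n^'m"
  shows "x \<bullet> (transpose A *v y) = (A *v x) \<bullet> y"
  by (metis dot_lmul_matrix inner_commute transpose_matrix_vector)

lemma sum_matrix_vector_mult:
  fixes A :: "'i \<Rightarrow> real^'n^'m"
  shows "(\<Sum>i\<in>I. A i) *v x = (\<Sum>i\<in>I. A i *v x)"
  by (induction I rule: infinite_finite_induct) (auto simp: matrix_vector_mult_add_rdistrib)

lemma transpose_sum:
  fixes A :: "'i \<Rightarrow> real^'n^'m"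
  shows "transpose (\<Sum>i\<in>I. A i) = (\<Sum>i\<in>I. transpose (A i))"
  by (simp add: vec_eq_iff transpose_def sum_component)

section \<open>Existence of the singular value decomposition\<close>

lemma exists_unit_orthogonal:
  fixes v :: "nat \<Rightarrow> 'a::euclidean_space"
  assumes "k < DIM('a)"
  obtains x where "norm x = 1" "\<forall>i<k. x \<bullet> v i = 0"
proof -
  have "dim (v ` {..<k}) \<le> card (v ` {..<k})" by (intro dim_le_card span_superset) auto
  also have "\<dots> \<le> k" using card_image_le[of "{..<k}" v] by simp
  finally have "dim (v ` {..<k}) < DIM('a)" using assms by simp
  then obtain x where x: "x \<noteq> 0" "\<And>y. y \<in> span (v ` {..<k}) \<Longrightarrow> orthogonal x y"
    using orthogonal_to_subspace_exists by blast
  have "\<forall>i<k. (x /\<^sub>R norm x) \<bullet> v i = 0"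
    using x(2)[OF span_base] by (auto simp: orthogonal_def)
  moreover have "norm (x /\<^sub>R norm x) = 1" using x(1) by simp
  ultimately show ?thesis using that by blast
qed

text \<open>The equality case of Cauchy-Schwarz: \<open>w\<close> satisfies the constraints itself,
  so its normalisation competes with \<open>y\<close> and forces
  \<open>norm w \<le> y \<bullet> w\<close>. This is the Lagrange condition for the maximisation in
  the next proof.\<close>

lemma maximal_linear_functional:
  fixes w y :: "'a::euclidean_space"
  assumes "norm y = 1" "\<And>z. norm z = 1 \<Longrightarrow> (\<forall>i<k. z \<bullet> u i = 0) \<Longrightarrow> z \<bullet> w \<le> y \<bullet> w"
    and "\<forall>i<k. w \<bullet> u i = 0" and "0 \<le> y \<bullet> w"
  shows "w = (y \<bullet> w) *\<^sub>R y"
proof -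
  have le: "norm w \<le> y \<bullet> w"
  proof (cases "w = 0")
    case False
    have "(w /\<^sub>R norm w) \<bullet> w \<le> y \<bullet> w"
      by (rule assms(2)) (use False assms(3) in auto)
    moreover have "(w /\<^sub>R norm w) \<bullet> w = norm w"
      using False by (simp add: dot_square_norm power2_eq_square)
    ultimately show ?thesis by simp
  qed (use assms(4) in simp)
  have "(norm (w - (y \<bullet> w) *\<^sub>R y))\<^sup>2 = (norm w)\<^sup>2 - 2 * (y \<bullet> w)\<^sup>2 + (y \<bullet> w)\<^sup>2 * (norm y)\<^sup>2"
    unfolding power2_norm_eq_inner
    by (simp add: inner_diff_left inner_diff_right inner_commute[of w y] power2_eq_square algebra_simps)
  also have "\<dots> \<le> 0" using power_mono[OF le norm_ge_zero, of 2] by (simp add: assms(1))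
  finally show ?thesis by simp
qed

text \<open>Deflation: the next pair maximises \<open>y \<bullet> (A *v x)\<close> over the unit
  vectors orthogonal to all earlier ones. The last conjunct strengthens the induction: every value
  found so far dominates the form on the remaining complement, so the next value cannot exceed
  it.\<close>

lemma partial_svd_exists:
  fixes A :: "real^'n^'m"
  assumes "k \<le> num_sv TYPE(real^'n^'m)"
  shows "\<exists>\<sigma> u v. orthonormal_on {..<k} u \<and> orthonormal_on {..<k} v \<and>
    (\<forall>l<k. 0 \<le> \<sigma> l \<and> A *v v l = \<sigma> l *\<^sub>R u l \<and> transpose A *v u l = \<sigma> l *\<^sub>R v l) \<and>
    (\<forall>i j. i \<le> j \<and> j < k \<longrightarrow> \<sigma> j \<le> \<sigma> i) \<and>
    (\<forall>x y l. l < k \<and> norm x = 1 \<and> norm y = 1 \<and> (\<forall>i<k. x \<bullet> v i = 0) \<and> (\<forall>i<k. y \<bullet> u i = 0)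
       \<longrightarrow> y \<bullet> (A *v x) \<le> \<sigma> l)"
  using assms
proof (induction k)
  case 0
  then show ?case by (auto simp: orthonormal_on_def)
next
  case (Suc k)
  then have k: "k \<le> num_sv TYPE(real^'n^'m)" by simp
  from Suc.IH[OF k] obtain \<sigma> u v where u: "orthonormal_on {..<k} u" and v: "orthonormal_on {..<k} v"
    and sv: "\<forall>l<k. 0 \<le> \<sigma> l \<and> A *v v l = \<sigma> l *\<^sub>R u l \<and> transpose A *v u l = \<sigma> l *\<^sub>R v l"
    and dec: "\<forall>i j. i \<le> j \<and> j < k \<longrightarrow> \<sigma> j \<le> \<sigma> i"
    and mx: "\<forall>x y l. l < k \<and> norm x = 1 \<and> norm y = 1 \<and> (\<forall>i<k. x \<bullet> v i = 0) \<and>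
      (\<forall>i<k. y \<bullet> u i = 0) \<longrightarrow> y \<bullet> (A *v x) \<le> \<sigma> l"
    by (elim exE conjE) (rule that; assumption)
  have \<sigma>: "0 \<le> \<sigma> l" and Av: "A *v v l = \<sigma> l *\<^sub>R u l" and Au: "transpose A *v u l = \<sigma> l *\<^sub>R v l"
    if "l < k" for l using sv that by auto
  define X where "X = sphere 0 1 \<inter> {x. \<forall>i<k. x \<bullet> v i = 0}"
  define Y where "Y = sphere 0 1 \<inter> {y. \<forall>i<k. y \<bullet> u i = 0}"
  have "k < DIM(real^'n)" "k < DIM(real^'m)" using Suc.prems by (auto simp: num_sv_def)
  then obtain x0 y0 where "norm x0 = 1" "\<forall>i<k. x0 \<bullet> v i = 0" "norm y0 = 1" "\<forall>i<k. y0 \<bullet> u i = 0"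
    using exists_unit_orthogonal[of k v] exists_unit_orthogonal[of k u] by metis
  then have "x0 \<in> X" "y0 \<in> Y" by (simp_all add: X_def Y_def)
  then have ne: "X \<noteq> {}" "Y \<noteq> {}" by auto
  have cl: "closed {x. \<forall>i<k. x \<bullet> w i = 0}" for w :: "nat \<Rightarrow> 'c::euclidean_space"
  proof -
    have "{x. \<forall>i<k. x \<bullet> w i = 0} = (\<Inter>i<k. {x. x \<bullet> w i = 0})" by auto
    moreover have "closed {x. x \<bullet> w i = 0}" for i
      by (intro closed_Collect_eq continuous_intros)
    ultimately show ?thesis by (metis (no_types, lifting) closed_INT)
  qed
  have cX: "compact X" "compact Y" unfolding X_def Y_def
    by (rule compact_Int_closed[OF compact_sphere cl])+
  have "continuous_on (X \<times> Y) (\<lambda>p. snd p \<bullet> (A *v fst p))"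
    by (intro continuous_intros bounded_linear.continuous_on[OF matrix_vector_mul_bounded_linear])
  then obtain p where p: "p \<in> X \<times> Y"
    and pm: "\<And>q. q \<in> X \<times> Y \<Longrightarrow> snd q \<bullet> (A *v fst q) \<le> snd p \<bullet> (A *v fst p)"
    using continuous_attains_sup[OF compact_Times[OF cX]] ne by blast
  obtain x y where xy: "p = (x, y)" by (cases p)
  define t where "t = y \<bullet> (A *v x)"
  have x: "norm x = 1" "\<forall>i<k. x \<bullet> v i = 0" and y: "norm y = 1" "\<forall>i<k. y \<bullet> u i = 0"
    using p by (auto simp: xy X_def Y_def)
  have max: "b \<bullet> (A *v a) \<le> t" if "norm a = 1" "\<forall>i<k. a \<bullet> v i = 0" "norm b = 1" "\<forall>i<k. b \<bullet> u i = 0" for a b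
    using pm[of "(a, b)"] that by (auto simp: xy X_def Y_def t_def)
  \<comment> \<open>The pair \<open>x\<close>, \<open>- y\<close> is admissible too and gives the
    value \<open>- t\<close>.\<close>
  have t0: "0 \<le> t" using max[of x "- y"] x y by (simp add: t_def)
  \<comment> \<open>With \<open>x\<close> fixed, \<open>y\<close> maximises the functional given by
    \<open>A *v x\<close>, which is orthogonal to the earlier \<open>u i\<close> because
    \<open>transpose A\<close> maps these to multiples of \<open>v i\<close>. The claim about
    \<open>transpose A *v y\<close> is the mirror image.\<close>
  have Ax: "A *v x = t *\<^sub>R y"
    unfolding t_def
  proof (rule maximal_linear_functional[where k = k and u = u])
    show "\<forall>i<k. (A *v x) \<bullet> u i = 0"
      by (simp add: inner_transpose_mult[symmetric] Au x)
  qed (use max x y t0 in \<open>auto simp: t_def\<close>)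
  have tt: "x \<bullet> (transpose A *v y) = t" by (simp add: inner_transpose_mult t_def inner_commute)
  have Ay: "transpose A *v y = t *\<^sub>R x"
    unfolding tt[symmetric]
  proof (rule maximal_linear_functional[where k = k and u = v])
    show "\<forall>i<k. (transpose A *v y) \<bullet> v i = 0"
      by (simp add: inner_commute[of "transpose A *v y"] inner_transpose_mult Av y inner_commute[of "u _"])
    show "z \<bullet> (transpose A *v y) \<le> x \<bullet> (transpose A *v y)" if "norm z = 1" "\<forall>i<k. z \<bullet> v i = 0" for z
      using max[OF that y] unfolding tt by (simp add: inner_transpose_mult inner_commute)
  qed (use t0 tt x in auto)
  have xx: "x \<bullet> x = 1" "y \<bullet> y = 1" using x y by (simp_all add: norm_eq_1)
  have O: "orthonormal_on {..<Suc k} (u(k := y))" "orthonormal_on {..<Suc k} (v(k := x))"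
    using u v x y xx by (auto simp: orthonormal_on_def less_Suc_eq inner_commute)
  have S: "\<forall>l<Suc k. 0 \<le> (\<sigma>(k := t)) l \<and> A *v (v(k := x)) l = (\<sigma>(k := t)) l *\<^sub>R (u(k := y)) l \<and>
     transpose A *v (u(k := y)) l = (\<sigma>(k := t)) l *\<^sub>R (v(k := x)) l"
    using \<sigma> Av Au Ax Ay t0 by (auto simp: less_Suc_eq)
  have tle: "t \<le> \<sigma> l" if "l < k" for l
    using mx that x y by (simp add: t_def)
  have D: "\<forall>i j. i \<le> j \<and> j < Suc k \<longrightarrow> (\<sigma>(k := t)) j \<le> (\<sigma>(k := t)) i"
    using dec tle by (auto simp: less_Suc_eq le_less)
  have M: "b \<bullet> (A *v a) \<le> (\<sigma>(k := t)) l"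
    if "l < Suc k" "norm a = 1" "norm b = 1" "\<forall>i<Suc k. a \<bullet> (v(k := x)) i = 0"
      "\<forall>i<Suc k. b \<bullet> (u(k := y)) i = 0" for a b l
  proof -
    have "\<forall>i<k. a \<bullet> v i = 0" "\<forall>i<k. b \<bullet> u i = 0"
      using that(4,5) by (metis less_SucI fun_upd_apply less_irrefl_nat)+
    with max[of a b] that have "b \<bullet> (A *v a) \<le> t" by blast
    then show ?thesis using tle that(1) by (force simp: less_Suc_eq)
  qed
  show ?case
    by (rule exI[of _ "\<sigma>(k := t)"], rule exI[of _ "u(k := y)"], rule exI[of _ "v(k := x)"],
        intro conjI O S D allI impI, elim conjE, rule M)
qed

lemma is_svd_iff:
  fixes M :: "real^'n^'m"
  shows "is_svd M \<sigma> u v \<longleftrightarrow> orthonormal_on {..<num_sv TYPE(real^'n^'m)} u \<and>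
     orthonormal_on {..<num_sv TYPE(real^'n^'m)} v \<and> (\<forall>k<num_sv TYPE(real^'n^'m). 0 \<le> \<sigma> k) \<and>
     (\<forall>k l. k \<le> l \<and> l < num_sv TYPE(real^'n^'m) \<longrightarrow> \<sigma> l \<le> \<sigma> k) \<and>
     M = (\<Sum>k<num_sv TYPE(real^'n^'m). \<sigma> k *\<^sub>R outer_prod (u k) (v k))"
  unfolding is_svd_def orthonormal_on_def Let_def by auto

lemma orthonormal_on_sum_inner:
  fixes w :: "'i \<Rightarrow> 'a::real_inner" and z :: "'i \<Rightarrow> 'b::real_vector"
  assumes "finite I" "l \<in> I" "orthonormal_on I w"
  shows "(\<Sum>k\<in>I. (\<sigma> k * (w k \<bullet> w l)) *\<^sub>R z k) = \<sigma> l *\<^sub>R z l"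
proof -
  have "(\<Sum>k\<in>I. (\<sigma> k * (w k \<bullet> w l)) *\<^sub>R z k) = (\<Sum>k\<in>I. if k = l then \<sigma> l *\<^sub>R z l else 0)"
    using assms by (intro sum.cong) (auto simp: orthonormal_onD)
  then show ?thesis using assms by simp
qed

lemma sum_outer_prod_vector_mult:
  fixes u :: "'i \<Rightarrow> real^'m" and v :: "'i \<Rightarrow> real^'n"
  shows "(\<Sum>k\<in>I. \<sigma> k *\<^sub>R outer_prod (u k) (v k)) *v x = (\<Sum>k\<in>I. (\<sigma> k * (v k \<bullet> x)) *\<^sub>R u k)"
  by (simp add: sum_matrix_vector_mult scaleR_matrix_vector_assoc[symmetric] outer_prod_vector_mult)

lemma transpose_sum_outer_prod:
  fixes u :: "'i \<Rightarrow> real^'m" and v :: "'i \<Rightarrow> real^'n"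
  shows "transpose (\<Sum>k\<in>I. \<sigma> k *\<^sub>R outer_prod (u k) (v k)) = (\<Sum>k\<in>I. \<sigma> k *\<^sub>R outer_prod (v k) (u k))"
  by (simp add: transpose_sum transpose_scalar transpose_outer_prod)

lemma svd_exists:
  fixes M :: "real^'n^'m"
  obtains \<sigma> u v where "is_svd M \<sigma> u v"
proof -
  let ?r = "num_sv TYPE(real^'n^'m)"
  obtain \<sigma> u v where u: "orthonormal_on {..<?r} u" and v: "orthonormal_on {..<?r} v"
    and \<sigma>: "\<forall>l<?r. 0 \<le> \<sigma> l \<and> M *v v l = \<sigma> l *\<^sub>R u l \<and> transpose M *v u l = \<sigma> l *\<^sub>R v l"
    and dec: "\<forall>i j. i \<le> j \<and> j < ?r \<longrightarrow> \<sigma> j \<le> \<sigma> i"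
    using partial_svd_exists[OF order_refl, of M] by blast
  let ?S = "\<Sum>k<?r. \<sigma> k *\<^sub>R outer_prod (u k) (v k)"
  have Sv: "?S *v v l = \<sigma> l *\<^sub>R u l" and Su: "transpose ?S *v u l = \<sigma> l *\<^sub>R v l" if "l < ?r" for l
    using that u v
    by (simp_all add: transpose_sum_outer_prod sum_outer_prod_vector_mult orthonormal_on_sum_inner)
  have "M = ?S"
  \<comment> \<open>With \<open>min m n\<close> orthonormal vectors on each side, at least one side
    is a full basis. Agreement on that basis suffices, after transposing if it is the left
    one.\<close>
  proof (cases "?r = CARD('n)")
    case True
    then have sp: "span (v ` {..<?r}) = UNIV"
      by (intro orthonormal_on_span v) auto
    have "M *v x = ?S *v x" for x
      by (rule linear_eq_on_span[OF matrix_vector_mul_linear matrix_vector_mul_linear, of "v ` {..<?r}"])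
         (use \<sigma> Sv sp in auto)
    then show ?thesis by (simp add: matrix_eq)
  next
    case False
    then have "?r = CARD('m)" by (auto simp: num_sv_def)
    then have sp: "span (u ` {..<?r}) = UNIV"
      by (intro orthonormal_on_span u) auto
    have "transpose M *v x = transpose ?S *v x" for x
      by (rule linear_eq_on_span[OF matrix_vector_mul_linear matrix_vector_mul_linear, of "u ` {..<?r}"])
         (use \<sigma> Su sp in auto)
    then have "transpose M = transpose ?S" by (simp add: matrix_eq)
    then show ?thesis by (metis transpose_transpose)
  qed
  then have "is_svd M \<sigma> u v" using u v \<sigma> dec by (auto simp: is_svd_iff)
  then show ?thesis using that by blast
qed

section \<open>Singular values, nuclear norm and operator norm\<close>

lemma svd_mult:
  fixes M :: "real^'n^'m"
  assumes "is_svd M \<sigma> u v" "l < num_sv TYPE(real^'n^'m)"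
  shows "M *v v l = \<sigma> l *\<^sub>R u l" "transpose M *v u l = \<sigma> l *\<^sub>R v l"
proof -
  let ?r = "num_sv TYPE(real^'n^'m)"
  from assms(1) have o: "orthonormal_on {..<?r} u" "orthonormal_on {..<?r} v"
    and M: "M = (\<Sum>k<?r. \<sigma> k *\<^sub>R outer_prod (u k) (v k))" by (auto simp: is_svd_iff)
  show "M *v v l = \<sigma> l *\<^sub>R u l" "transpose M *v u l = \<sigma> l *\<^sub>R v l"
    unfolding M using assms(2) o
    by (simp_all add: transpose_sum_outer_prod sum_outer_prod_vector_mult orthonormal_on_sum_inner)
qed

lemma svd_orthonormal:
  fixes M :: "real^'n^'m"
  assumes "is_svd M \<sigma> u v" "k \<le> num_sv TYPE(real^'n^'m)"
  shows "orthonormal_on {..<k} u" "orthonormal_on {..<k} v"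
  using assms by (auto simp: is_svd_iff intro: orthonormal_on_subset)

lemma svd_inner:
  fixes M :: "real^'n^'m"
  assumes "is_svd M \<sigma> u v" "l < num_sv TYPE(real^'n^'m)"
  shows "u l \<bullet> (M *v v l) = \<sigma> l"
  using orthonormal_onD[OF svd_orthonormal(1)[OF assms(1) order_refl], of l l] assms(2)
  by (simp add: svd_mult(1)[OF assms])

lemma inner_svd:
  fixes M :: "real^'n^'m"
  assumes "is_svd M \<sigma> u v"
  shows "W \<bullet> M = (\<Sum>l<num_sv TYPE(real^'n^'m). \<sigma> l * (u l \<bullet> (W *v v l)))"
  using assms unfolding is_svd_iff
  by (metis (mono_tags, lifting) inner_sum_right inner_scaleR_right inner_outer_prod_right sum.cong)

text \<open>A fractional knapsack: with unit capacities and total weight \<open>k\<close>, it is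
  best to put weight 1 on the \<open>k\<close> largest values.\<close>

lemma weighted_sum_le:
  fixes \<sigma> c :: "nat \<Rightarrow> real"
  assumes "k \<le> r" and nn: "\<And>j. j < r \<Longrightarrow> 0 \<le> \<sigma> j" and dec: "\<And>i j. i \<le> j \<Longrightarrow> j < r \<Longrightarrow> \<sigma> j \<le> \<sigma> i"
    and c: "\<And>j. j < r \<Longrightarrow> c j \<le> 1" and "(\<Sum>j<r. \<bar>c j\<bar>) \<le> real k"
  shows "(\<Sum>j<r. \<sigma> j * c j) \<le> (\<Sum>j<k. \<sigma> j)"
proof (cases "k = r")
  case True
  have "\<sigma> j * c j \<le> \<sigma> j" if "j < r" for j
    using mult_left_mono[OF c nn, OF that that] by simp
  then show ?thesis unfolding True by (intro sum_mono) auto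
next
  case False
  then have k: "k < r" using assms(1) by simp
  \<comment> \<open>\<open>\<sigma> k\<close> serves as pivot: what exceeds it is counted at most
    once for \<open>j < k\<close>, and the rest is charged to the total weight. With
    \<open>k = r\<close> there is no pivot, hence the separate case.\<close>
  have "\<sigma> j * c j \<le> (if j < k then \<sigma> j - \<sigma> k else 0) + \<sigma> k * \<bar>c j\<bar>" if j: "j < r" for j
  proof (cases "j < k")
    case True
    have "(\<sigma> j - \<sigma> k) * c j \<le> (\<sigma> j - \<sigma> k) * 1"
      by (rule mult_left_mono) (use c[OF j] dec[of j k] k True in auto)
    moreover have "\<sigma> k * c j \<le> \<sigma> k * \<bar>c j\<bar>" using nn[OF k] by (simp add: mult_left_mono)
    ultimately show ?thesis using True by (simp add: algebra_simps)
  next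
    case False
    have "\<sigma> j * c j \<le> \<sigma> j * \<bar>c j\<bar>" using nn[OF j] by (simp add: mult_left_mono)
    also have "\<dots> \<le> \<sigma> k * \<bar>c j\<bar>" using dec[of k j] False j by (intro mult_right_mono) auto
    finally show ?thesis using False by simp
  qed
  then have "(\<Sum>j<r. \<sigma> j * c j) \<le> (\<Sum>j<r. (if j < k then \<sigma> j - \<sigma> k else 0) + \<sigma> k * \<bar>c j\<bar>)"
    by (intro sum_mono) auto
  also have "\<dots> = (\<Sum>j<r. if j < k then \<sigma> j - \<sigma> k else 0) + \<sigma> k * (\<Sum>j<r. \<bar>c j\<bar>)"
    by (simp add: sum.distrib sum_distrib_left)
  also have "(\<Sum>j<r. if j < k then \<sigma> j - \<sigma> k else 0) = (\<Sum>j<k. \<sigma> j - \<sigma> k)"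
    using k by (intro sum.mono_neutral_cong_right) auto
  also have "\<dots> = (\<Sum>j<k. \<sigma> j) - \<sigma> k * real k" by (simp add: sum_subtractf)
  finally show ?thesis using mult_left_mono[OF assms(5) nn[OF k]] by simp
qed

text \<open>Uniqueness of the singular values, the triangle inequality and von Neumann's trace inequality
  all come from this maximum principle.\<close>

lemma ky_fan:
  fixes M :: "real^'n^'m"
  assumes svd: "is_svd M \<sigma> u v" and k: "k \<le> num_sv TYPE(real^'n^'m)"
    and a: "orthonormal_on {..<k} a" and b: "orthonormal_on {..<k} b"
  shows "(\<Sum>i<k. a i \<bullet> (M *v b i)) \<le> (\<Sum>i<k. \<sigma> i)"
proof -
  let ?r = "num_sv TYPE(real^'n^'m)"
  from svd have u: "orthonormal_on {..<?r} u" and v: "orthonormal_on {..<?r} v"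
    and M: "M = (\<Sum>k<?r. \<sigma> k *\<^sub>R outer_prod (u k) (v k))"
    and nn: "\<And>j. j < ?r \<Longrightarrow> 0 \<le> \<sigma> j" and dec: "\<And>i j. i \<le> j \<Longrightarrow> j < ?r \<Longrightarrow> \<sigma> j \<le> \<sigma> i"
    by (auto simp: is_svd_iff)
  \<comment> \<open>The trace becomes a weighted sum of singular values. Bessel for \<open>a\<close>
    and \<open>b\<close>, tested on \<open>u j\<close> and \<open>v j\<close>, bounds each weight by
    1; Bessel for \<open>u\<close> and \<open>v\<close>, tested on \<open>a i\<close> and
    \<open>b i\<close>, bounds their total by \<open>k\<close>.\<close>
  define c where "c j = (\<Sum>i<k. (a i \<bullet> u j) * (b i \<bullet> v j))" for j
  have c1: "\<bar>c j\<bar> \<le> (\<Sum>i<k. \<bar>a i \<bullet> u j\<bar> * \<bar>b i \<bullet> v j\<bar>)" for j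
    unfolding c_def by (rule order_trans[OF sum_abs]) (simp add: abs_mult)
  have "(\<Sum>i<k. a i \<bullet> (M *v b i)) = (\<Sum>i<k. \<Sum>j<?r. \<sigma> j * ((a i \<bullet> u j) * (b i \<bullet> v j)))"
    unfolding M sum_outer_prod_vector_mult
    by (simp add: inner_sum_right inner_commute[of "v _" "b _"] mult_ac)
  also have "\<dots> = (\<Sum>j<?r. \<sigma> j * c j)"
    unfolding c_def sum_distrib_left by (rule sum.swap)
  also have "\<dots> \<le> (\<Sum>i<k. \<sigma> i)"
  proof (rule weighted_sum_le[OF k nn dec])
    fix j assume j: "j < ?r"
    have "(\<Sum>i<k. \<bar>a i \<bullet> u j\<bar> * \<bar>b i \<bullet> v j\<bar>) \<le> 1"
      by (rule bessel_abs_product[OF _ a b])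
         (use j orthonormal_on_norm[OF u, of j] orthonormal_on_norm[OF v, of j] in auto)
    then show "c j \<le> 1" using c1[of j] by linarith
  next
    have "(\<Sum>j<?r. \<bar>c j\<bar>) \<le> (\<Sum>j<?r. \<Sum>i<k. \<bar>a i \<bullet> u j\<bar> * \<bar>b i \<bullet> v j\<bar>)"
      by (intro sum_mono c1)
    also have "\<dots> = (\<Sum>i<k. \<Sum>j<?r. \<bar>u j \<bullet> a i\<bar> * \<bar>v j \<bullet> b i\<bar>)"
      by (subst sum.swap) (simp add: inner_commute)
    also have "\<dots> \<le> (\<Sum>i<k. 1)"
    proof (rule sum_mono)
      fix i assume "i \<in> {..<k}"
      then show "(\<Sum>j<?r. \<bar>u j \<bullet> a i\<bar> * \<bar>v j \<bullet> b i\<bar>) \<le> 1"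
        by (intro bessel_abs_product[OF _ u v])
           (auto simp: orthonormal_on_norm[OF a] orthonormal_on_norm[OF b])
    qed
    finally show "(\<Sum>j<?r. \<bar>c j\<bar>) \<le> real k" by simp
  qed
  finally show ?thesis .
qed

lemma svd_sum_inner:
  fixes M :: "real^'n^'m"
  assumes "is_svd M \<sigma> u v" "k \<le> num_sv TYPE(real^'n^'m)"
  shows "(\<Sum>i<k. u i \<bullet> (M *v v i)) = (\<Sum>i<k. \<sigma> i)"
  using assms by (intro sum.cong) (auto simp: svd_inner)

text \<open>Each decomposition supplies test families for the other, so Ky Fan in both directions
  equates all partial sums; a singular value is the difference of two consecutive ones.\<close>

lemma svd_unique:
  fixes M :: "real^'n^'m"
  assumes "is_svd M \<sigma> u v" "is_svd M \<sigma>' u' v'" "k < num_sv TYPE(real^'n^'m)"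
  shows "\<sigma> k = \<sigma>' k"
proof -
  have le: "(\<Sum>i<j. \<tau> i) \<le> (\<Sum>i<j. \<tau>' i)"
    if "is_svd M \<tau> a b" "is_svd M \<tau>' a' b'" "j \<le> num_sv TYPE(real^'n^'m)" for \<tau> a b \<tau>' a' b' j
    using ky_fan[OF that(2,3) svd_orthonormal[OF that(1,3)]] svd_sum_inner[OF that(1,3)] by simp
  have "(\<Sum>i<j. \<sigma> i) = (\<Sum>i<j. \<sigma>' i)" if "j \<le> num_sv TYPE(real^'n^'m)" for j
    using le[OF assms(1,2) that] le[OF assms(2,1) that] by simp
  from this[of k] this[of "Suc k"] assms(3) show ?thesis by simp
qed

lemma singular_value_eq:
  fixes M :: "real^'n^'m"
  assumes "is_svd M \<sigma> u v" "k < num_sv TYPE(real^'n^'m)"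
  shows "singular_value M k = \<sigma> k"
  unfolding singular_value_def
  by (rule the_equality) (use assms svd_unique in blast)+

lemma svd_singular_value:
  fixes M :: "real^'n^'m"
  obtains u v where "is_svd M (singular_value M) u v"
proof -
  obtain \<sigma> u v where svd: "is_svd M \<sigma> u v" by (rule svd_exists)
  have "(\<Sum>l<num_sv TYPE(real^'n^'m). singular_value M l *\<^sub>R outer_prod (u l) (v l)) =
      (\<Sum>l<num_sv TYPE(real^'n^'m). \<sigma> l *\<^sub>R outer_prod (u l) (v l))"
    by (intro sum.cong) (auto simp: singular_value_eq[OF svd])
  then have "is_svd M (singular_value M) u v"
    using svd unfolding is_svd_iff by (auto simp flip: singular_value_eq[OF svd])
  then show ?thesis using that by blast
qed

lemma singular_value_nonneg:
  fixes M :: "real^'n^'m"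
  shows "l < num_sv TYPE(real^'n^'m) \<Longrightarrow> 0 \<le> singular_value M l"
  by (rule svd_singular_value[of M]) (auto simp: is_svd_iff)

lemma singular_value_decreasing:
  fixes M :: "real^'n^'m"
  shows "k \<le> l \<Longrightarrow> l < num_sv TYPE(real^'n^'m) \<Longrightarrow> singular_value M l \<le> singular_value M k"
  by (rule svd_singular_value[of M]) (auto simp: is_svd_iff)

lemma num_sv_pos: "0 < num_sv TYPE(real^'n^'m)"
  by (simp add: num_sv_def)

section \<open>The nuclear norm: variational form, norm axioms, duality\<close>

lemma sum_inner_le_nuclear_norm:
  fixes M :: "real^'n^'m"
  assumes "orthonormal_on {..<num_sv TYPE(real^'n^'m)} a" "orthonormal_on {..<num_sv TYPE(real^'n^'m)} b"
  shows "(\<Sum>i<num_sv TYPE(real^'n^'m). a i \<bullet> (M *v b i)) \<le> nuclear_norm M"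
  unfolding nuclear_norm_def
  by (rule svd_singular_value[of M]) (rule ky_fan[OF _ order_refl assms])

text \<open>This exhibits the norm as a supremum of linear functionals, from which subadditivity and
  closedness of the ball follow at once.\<close>

lemma nuclear_norm_le_iff:
  fixes M :: "real^'n^'m"
  shows "nuclear_norm M \<le> R \<longleftrightarrow>
    (\<forall>a b. orthonormal_on {..<num_sv TYPE(real^'n^'m)} a \<and> orthonormal_on {..<num_sv TYPE(real^'n^'m)} b
      \<longrightarrow> (\<Sum>i<num_sv TYPE(real^'n^'m). a i \<bullet> (M *v b i)) \<le> R)" (is "?l \<longleftrightarrow> ?r")
proof
  assume ?l
  show ?r using order_trans[OF sum_inner_le_nuclear_norm \<open>?l\<close>] by blast
next
  assume ?r
  obtain u v where svd: "is_svd M (singular_value M) u v" by (rule svd_singular_value)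
  show ?l
    using \<open>?r\<close> svd_orthonormal[OF svd order_refl] svd_sum_inner[OF svd order_refl]
    unfolding nuclear_norm_def by metis
qed

lemma nuclear_norm_triangle:
  fixes A B :: "real^'n^'m"
  shows "nuclear_norm (A + B) \<le> nuclear_norm A + nuclear_norm B"
proof -
  have "(\<Sum>i<num_sv TYPE(real^'n^'m). a i \<bullet> ((A + B) *v b i)) \<le> nuclear_norm A + nuclear_norm B"
    if "orthonormal_on {..<num_sv TYPE(real^'n^'m)} a" "orthonormal_on {..<num_sv TYPE(real^'n^'m)} b" for a b
    using add_mono[OF sum_inner_le_nuclear_norm[OF that] sum_inner_le_nuclear_norm[OF that]]
    by (simp add: matrix_vector_mult_add_rdistrib inner_add_right sum.distrib)
  then show ?thesis by (simp add: nuclear_norm_le_iff)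
qed

lemma nuclear_norm_svd:
  fixes M :: "real^'n^'m"
  shows "is_svd M \<sigma> u v \<Longrightarrow> nuclear_norm M = (\<Sum>l<num_sv TYPE(real^'n^'m). \<sigma> l)"
  by (simp add: nuclear_norm_def singular_value_eq)

lemma nuclear_norm_scaleR:
  fixes M :: "real^'n^'m"
  assumes "0 \<le> c"
  shows "nuclear_norm (c *\<^sub>R M) = c * nuclear_norm M"
proof -
  obtain u v where svd: "is_svd M (singular_value M) u v" by (rule svd_singular_value)
  then have "c *\<^sub>R M = c *\<^sub>R (\<Sum>l<num_sv TYPE(real^'n^'m). singular_value M l *\<^sub>R outer_prod (u l) (v l))"
    unfolding is_svd_iff by metis
  then have "is_svd (c *\<^sub>R M) (\<lambda>l. c * singular_value M l) u v"
    using svd assms by (simp add: is_svd_iff mult_left_mono scaleR_sum_right)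
  from nuclear_norm_svd[OF this] show ?thesis by (simp add: nuclear_norm_def sum_distrib_left)
qed

lemma nuclear_norm_minus:
  fixes M :: "real^'n^'m"
  shows "nuclear_norm (- M) = nuclear_norm M"
proof -
  obtain u v where svd: "is_svd M (singular_value M) u v" by (rule svd_singular_value)
  have "outer_prod (- a) b = - outer_prod a b" for a :: "real^'m" and b :: "real^'n"
    by (simp add: outer_prod_def vec_eq_iff)
  moreover have "- M = - (\<Sum>l<num_sv TYPE(real^'n^'m). singular_value M l *\<^sub>R outer_prod (u l) (v l))"
    using svd unfolding is_svd_iff by metis
  ultimately have "is_svd (- M) (singular_value M) (\<lambda>l. - u l) v"
    using svd by (simp add: is_svd_iff orthonormal_on_def sum_negf)
  from nuclear_norm_svd[OF this] show ?thesis by (simp add: nuclear_norm_def)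
qed

lemma nuclear_norm_nonneg:
  fixes M :: "real^'n^'m"
  shows "0 \<le> nuclear_norm M"
  unfolding nuclear_norm_def by (intro sum_nonneg singular_value_nonneg) simp

lemma inner_le_nuclear_norm_op_norm:
  fixes A B :: "real^'n^'m"
  shows "A \<bullet> B \<le> nuclear_norm A * op_norm B"
proof -
  let ?r = "num_sv TYPE(real^'n^'m)"
  obtain u v where A: "is_svd A (singular_value A) u v" by (rule svd_singular_value)
  obtain u' v' where B: "is_svd B (singular_value B) u' v'" by (rule svd_singular_value)
  have b: "u l \<bullet> (B *v v l) \<le> op_norm B" if "l < ?r" for l
  proof -
    \<comment> \<open>Ky Fan with \<open>k = 1\<close>: the constant families are orthonormal on a
      single index.\<close>
    have "(\<Sum>i<1::nat. u l \<bullet> (B *v v l)) \<le> (\<Sum>i<1. singular_value B i)"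
      by (rule ky_fan[OF B]) (use num_sv_pos[where 'n='n and 'm='m] that A in \<open>auto simp: orthonormal_on_def is_svd_iff\<close>)
    then have "u l \<bullet> (B *v v l) \<le> singular_value B 0" by simp
    also have "\<dots> \<le> op_norm B" unfolding op_norm_def
      using num_sv_pos[where 'n='n and 'm='m] by (intro Max_ge) auto
    finally show ?thesis .
  qed
  have "A \<bullet> B = (\<Sum>l<?r. singular_value A l * (u l \<bullet> (B *v v l)))"
    unfolding inner_commute[of A] by (rule inner_svd[OF A])
  also have "\<dots> \<le> (\<Sum>l<?r. singular_value A l * op_norm B)"
    by (intro sum_mono mult_left_mono b singular_value_nonneg) auto
  finally show ?thesis by (simp add: nuclear_norm_def sum_distrib_right)
qed

text \<open>Duality for a test matrix that is only known to be a contraction, so that its singular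
  values need not be computed. It serves for the sum of two partial isometries below.\<close>

lemma inner_contraction_le_nuclear_norm:
  fixes W X :: "real^'n^'m"
  assumes "\<And>x. norm (W *v x) \<le> norm x"
  shows "W \<bullet> X \<le> nuclear_norm X"
proof -
  obtain u v where X: "is_svd X (singular_value X) u v" by (rule svd_singular_value)
  have "u l \<bullet> (W *v v l) \<le> 1" if "l < num_sv TYPE(real^'n^'m)" for l
    using norm_cauchy_schwarz[of "u l" "W *v v l"] assms[of "v l"] that
      orthonormal_on_norm[OF svd_orthonormal(1)[OF X order_refl], of l]
      orthonormal_on_norm[OF svd_orthonormal(2)[OF X order_refl], of l] by simp
  then have "W \<bullet> X \<le> (\<Sum>l<num_sv TYPE(real^'n^'m). singular_value X l * 1)"
    unfolding inner_svd[OF X] by (intro sum_mono mult_left_mono singular_value_nonneg) auto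
  then show ?thesis by (simp add: nuclear_norm_def)
qed

lemma norm_svd:
  fixes M :: "real^'n^'m"
  assumes "is_svd M \<sigma> u v"
  shows "(norm M)\<^sup>2 = (\<Sum>l<num_sv TYPE(real^'n^'m). (\<sigma> l)\<^sup>2)"
proof -
  have "(norm M)\<^sup>2 = (\<Sum>l<num_sv TYPE(real^'n^'m). \<sigma> l * (u l \<bullet> (M *v v l)))"
    unfolding power2_norm_eq_inner by (rule inner_svd[OF assms])
  also have "\<dots> = (\<Sum>l<num_sv TYPE(real^'n^'m). (\<sigma> l)\<^sup>2)"
    by (intro sum.cong) (auto simp: svd_inner[OF assms] power2_eq_square)
  finally show ?thesis .
qed

lemma norm_le_nuclear_norm:
  fixes M :: "real^'n^'m"
  shows "norm M \<le> nuclear_norm M"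
proof -
  obtain u v where svd: "is_svd M (singular_value M) u v" by (rule svd_singular_value)
  let ?s = "singular_value M"
  have "(norm M)\<^sup>2 = (\<Sum>l<num_sv TYPE(real^'n^'m). ?s l * ?s l)"
    unfolding norm_svd[OF svd] by (simp add: power2_eq_square)
  also have "\<dots> \<le> (\<Sum>l<num_sv TYPE(real^'n^'m). ?s l * nuclear_norm M)"
    unfolding nuclear_norm_def
    by (intro sum_mono mult_left_mono member_le_sum singular_value_nonneg) (auto intro: singular_value_nonneg)
  also have "\<dots> = (nuclear_norm M)\<^sup>2"
    by (simp add: nuclear_norm_def sum_distrib_right[symmetric] power2_eq_square)
  finally show ?thesis using nuclear_norm_nonneg by (rule power2_le_imp_le)
qed

text \<open>If the value at index \<open>l\<close> were nonzero, so would be all earlier ones, and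
  the range of \<open>M\<close> would contain the \<open>l + 1\<close> independent vectors
  \<open>u 0\<close>, ..., \<open>u l\<close>.\<close>

lemma singular_value_eq_0_of_rank_le:
  fixes M :: "real^'n^'m"
  assumes "rank M \<le> l" "l < num_sv TYPE(real^'n^'m)"
  shows "singular_value M l = 0"
proof (rule ccontr)
  assume ne: "singular_value M l \<noteq> 0"
  obtain u v where svd: "is_svd M (singular_value M) u v" by (rule svd_singular_value)
  have o: "orthonormal_on {..<Suc l} u" using assms(2) by (intro svd_orthonormal[OF svd]) simp
  have "u ` {..<Suc l} \<subseteq> range ((*v) M)"
  proof safe
    fix i assume "i < Suc l"
    then have i: "i \<le> l" "i < num_sv TYPE(real^'n^'m)" using assms(2) by auto
    have "singular_value M i \<noteq> 0"
      using singular_value_decreasing[OF i(1) assms(2), of M] singular_value_nonneg[OF assms(2), of M] ne by simp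
    then have "M *v ((1 / singular_value M i) *\<^sub>R v i) = u i"
      by (simp add: matrix_vector_mult_scaleR svd_mult(1)[OF svd i(2)])
    then show "u i \<in> range ((*v) M)" by (metis rangeI)
  qed
  then have "card (u ` {..<Suc l}) \<le> dim (range ((*v) M))"
    by (intro independent_card_le_dim orthonormal_on_card(2)[OF _ o]) auto
  then have "Suc l \<le> rank M"
    by (simp add: rank_dim_range card_image[OF orthonormal_on_card(1)[OF _ o]])
  then show False using assms(1) by simp
qed

text \<open>Cauchy-Schwarz over at most \<open>k\<close> nonzero singular values. This conversion
  between the two norms is the source of every factor \<open>s\<close> in the convergence
  rate.\<close>

lemma nuclear_norm_square_le:
  fixes M :: "real^'n^'m"
  assumes "rank M \<le> k"
  shows "(nuclear_norm M)\<^sup>2 \<le> real k * (norm M)\<^sup>2"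
proof -
  let ?r = "num_sv TYPE(real^'n^'m)" and ?s = "singular_value M"
  obtain u v where svd: "is_svd M ?s u v" by (rule svd_singular_value)
  have "nuclear_norm M = (\<Sum>l\<in>{..<?r} \<inter> {..<k}. ?s l)"
    unfolding nuclear_norm_def using assms
    by (intro sum.mono_neutral_right) (auto intro!: singular_value_eq_0_of_rank_le)
  then have "(nuclear_norm M)\<^sup>2 \<le> (\<Sum>l\<in>{..<?r} \<inter> {..<k}. (?s l)\<^sup>2) * card ({..<?r} \<inter> {..<k})"
    by (simp only: sum_squared_le_sum_of_squares)
  also have "\<dots> \<le> (norm M)\<^sup>2 * real k"
    unfolding norm_svd[OF svd]
    using card_mono[of "{..<k}" "{..<?r} \<inter> {..<k}"]
    by (intro mult_mono sum_mono2) (auto intro: sum_nonneg)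
  finally show ?thesis by (simp add: mult.commute)
qed

lemma rank_sum_outer_prod_le:
  fixes u :: "nat \<Rightarrow> real^'m" and v :: "nat \<Rightarrow> real^'n"
  shows "rank (\<Sum>l<s. c l *\<^sub>R outer_prod (u l) (v l)) \<le> s"
proof -
  have "range ((*v) (\<Sum>l<s. c l *\<^sub>R outer_prod (u l) (v l))) \<subseteq> span (u ` {..<s})"
    unfolding sum_outer_prod_vector_mult
    by (intro image_subsetI span_sum span_scale span_base) auto
  then have "rank (\<Sum>l<s. c l *\<^sub>R outer_prod (u l) (v l)) \<le> dim (span (u ` {..<s}))"
    unfolding rank_dim_range by (rule dim_subset)
  also have "\<dots> \<le> card (u ` {..<s})" by (simp add: dim_le_card')
  also have "\<dots> \<le> s" using card_image_le[of "{..<s}" u] by simp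
  finally show ?thesis .
qed

text \<open>Abel summation in inductive form: the weighted sum dominates the last weight times the
  plain partial sum, and lowering that weight only weakens the bound since the partial sum is
  nonnegative.\<close>

lemma decreasing_weighted_sum_nonneg:
  fixes w x :: "nat \<Rightarrow> real"
  assumes nn: "\<And>i. i < r \<Longrightarrow> 0 \<le> w i" and dec: "\<And>i j. i \<le> j \<Longrightarrow> j < r \<Longrightarrow> w j \<le> w i"
    and x: "\<And>k. k \<le> r \<Longrightarrow> 0 \<le> (\<Sum>i<k. x i)"
  shows "0 \<le> (\<Sum>i<r. w i * x i)"
proof -
  have *: "w k * (\<Sum>i<Suc k. x i) \<le> (\<Sum>i<Suc k. w i * x i)" if "k < r" for k
    using that
  proof (induction k)
    case (Suc k)
    have "w (Suc k) * (\<Sum>i<Suc k. x i) \<le> w k * (\<Sum>i<Suc k. x i)"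
      using Suc.prems by (intro mult_right_mono dec x) auto
    also have "\<dots> \<le> (\<Sum>i<Suc k. w i * x i)" using Suc by simp
    finally show ?case unfolding sum.lessThan_Suc[of _ "Suc k"] distrib_left by simp
  qed simp
  show ?thesis
  proof (cases r)
    case (Suc k)
    have "0 \<le> w k * (\<Sum>i<Suc k. x i)" using nn[of k] x[of "Suc k"] Suc by (intro mult_nonneg_nonneg) auto
    also have "\<dots> \<le> (\<Sum>i<Suc k. w i * x i)" using * Suc by blast
    finally show ?thesis by (simp only: Suc)
  qed simp
qed

text \<open>Ky Fan compares only partial sums of \<open>u l \<bullet> (B *v v l)\<close> with those
  of the singular values of \<open>B\<close>, not single terms. Because the weights, the singular
  values of \<open>A\<close>, decrease, this is enough.\<close>

lemma von_neumann_trace: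
  fixes A B :: "real^'n^'m"
  shows "A \<bullet> B \<le> (\<Sum>l<num_sv TYPE(real^'n^'m). singular_value A l * singular_value B l)"
proof -
  let ?r = "num_sv TYPE(real^'n^'m)"
  obtain u v where A: "is_svd A (singular_value A) u v" by (rule svd_singular_value)
  obtain u' v' where B: "is_svd B (singular_value B) u' v'" by (rule svd_singular_value)
  have "0 \<le> (\<Sum>l<?r. singular_value A l * (singular_value B l - u l \<bullet> (B *v v l)))"
  proof (rule decreasing_weighted_sum_nonneg)
    fix k assume k: "k \<le> ?r"
    show "0 \<le> (\<Sum>i<k. singular_value B i - u i \<bullet> (B *v v i))"
      using ky_fan[OF B k svd_orthonormal[OF A k]] by (simp add: sum_subtractf)
  qed (auto intro: singular_value_nonneg singular_value_decreasing)
  then show ?thesis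
    unfolding inner_commute[of A] inner_svd[OF A] by (simp add: right_diff_distrib sum_subtractf)
qed

section \<open>Compactness and convexity of the nuclear ball\<close>

lemma closed_nuclear_ball: "closed (nuclear_ball R :: (real^'n^'m) set)"
proof -
  \<comment> \<open>By the variational form the ball is an intersection of closed half-spaces, one
    for each pair of orthonormal families.\<close>
  have "nuclear_ball R = (\<Inter>a \<in> {a. orthonormal_on {..<num_sv TYPE(real^'n^'m)} a}.
     \<Inter>b \<in> {b. orthonormal_on {..<num_sv TYPE(real^'n^'m)} b}.
       {X :: real^'n^'m. (\<Sum>i<num_sv TYPE(real^'n^'m). X \<bullet> outer_prod (a i) (b i)) \<le> R})"
    by (auto simp: nuclear_ball_def nuclear_norm_le_iff inner_outer_prod_right)
  also have "closed \<dots>"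
    by (intro closed_INT ballI closed_Collect_le continuous_intros)
  finally show ?thesis .
qed

lemma compact_nuclear_ball: "compact (nuclear_ball R :: (real^'n^'m) set)"
proof -
  have "nuclear_ball R \<subseteq> (cball 0 R :: (real^'n^'m) set)"
    using norm_le_nuclear_norm by (force simp: nuclear_ball_def dist_norm intro: order_trans)
  then have "bounded (nuclear_ball R :: (real^'n^'m) set)"
    by (rule bounded_subset[OF bounded_cball])
  then show ?thesis using closed_nuclear_ball compact_eq_bounded_closed by blast
qed

lemma nuclear_norm_0: "nuclear_norm (0 :: real^'n^'m) = 0"
  using nuclear_norm_scaleR[of 0 "0 :: real^'n^'m"] by simp

lemma convex_nuclear_ball: "convex (nuclear_ball R :: (real^'n^'m) set)"
proof (rule convexI)
  fix x y :: "real^'n^'m" and a b :: real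
  assume x: "x \<in> nuclear_ball R" and y: "y \<in> nuclear_ball R" and ab: "0 \<le> a" "0 \<le> b" "a + b = 1"
  have "nuclear_norm (a *\<^sub>R x + b *\<^sub>R y) \<le> a * nuclear_norm x + b * nuclear_norm y"
    using nuclear_norm_triangle[of "a *\<^sub>R x" "b *\<^sub>R y"] ab by (simp add: nuclear_norm_scaleR)
  also have "\<dots> \<le> a * R + b * R"
    using x y ab by (intro add_mono mult_left_mono) (auto simp: nuclear_ball_def)
  finally show "a *\<^sub>R x + b *\<^sub>R y \<in> nuclear_ball R"
    using ab by (simp add: nuclear_ball_def distrib_right[symmetric])
qed

section \<open>Low-rank approximation\<close>

text \<open>The Frobenius case of Mirsky's inequality. The squared norms are functions of the
  singular values, so only the mixed term differs, and the trace inequality controls it.\<close>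

lemma sum_square_diff_singular_value_le:
  fixes W Y :: "real^'n^'m"
  shows "(\<Sum>l<num_sv TYPE(real^'n^'m). (singular_value W l - singular_value Y l)\<^sup>2) \<le> (norm (W - Y))\<^sup>2"
proof -
  let ?r = "num_sv TYPE(real^'n^'m)"
  have n: "(norm M)\<^sup>2 = (\<Sum>l<?r. (singular_value M l)\<^sup>2)" for M :: "real^'n^'m"
    by (rule svd_singular_value[of M]) (rule norm_svd)
  have "(\<Sum>l<?r. (singular_value W l - singular_value Y l)\<^sup>2) =
      (norm W)\<^sup>2 + (norm Y)\<^sup>2 - 2 * (\<Sum>l<?r. singular_value W l * singular_value Y l)"
    by (simp add: n power2_diff sum.distrib sum_subtractf sum_distrib_left mult.assoc)
  also have "\<dots> \<le> (norm W)\<^sup>2 + (norm Y)\<^sup>2 - 2 * (W \<bullet> Y)"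
    using von_neumann_trace[of W Y] by simp
  also have "\<dots> = (norm (W - Y))\<^sup>2"
    by (simp add: power2_norm_eq_inner inner_diff_left inner_diff_right inner_commute)
  finally show ?thesis .
qed

lemma sum_lessThan_split:
  fixes h :: "nat \<Rightarrow> real"
  assumes "s \<le> r"
  shows "(\<Sum>l<r. h l) = (\<Sum>l<s. h l) + (\<Sum>l=s..<r. h l)"
  using assms by (simp add: lessThan_atLeast0 sum.atLeastLessThan_concat)

text \<open>The singular values of \<open>W\<close> from index \<open>s\<close> on vanish, so the
  tail of \<open>Y\<close> is an unavoidable error. The next lemma shows that combinations of the
  singular pairs of \<open>Y\<close> itself attain such a bound.\<close>

lemma low_rank_dist_ge:
  fixes W Y :: "real^'n^'m"
  assumes "rank W \<le> s" "s \<le> num_sv TYPE(real^'n^'m)" "is_svd Y \<sigma> u v"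
  shows "(\<Sum>l<s. (singular_value W l - \<sigma> l)\<^sup>2) + (\<Sum>l=s..<num_sv TYPE(real^'n^'m). (\<sigma> l)\<^sup>2)
    \<le> (norm (W - Y))\<^sup>2"
proof -
  let ?r = "num_sv TYPE(real^'n^'m)"
  have "(\<Sum>l<s. (singular_value W l - \<sigma> l)\<^sup>2) + (\<Sum>l=s..<?r. (\<sigma> l)\<^sup>2) =
      (\<Sum>l<s. (singular_value W l - \<sigma> l)\<^sup>2) + (\<Sum>l=s..<?r. (singular_value W l - \<sigma> l)\<^sup>2)"
    using assms(1) by (simp add: singular_value_eq_0_of_rank_le)
  also have "\<dots> = (\<Sum>l<?r. (singular_value W l - singular_value Y l)\<^sup>2)"
    using sum_lessThan_split[OF assms(2), of "\<lambda>l. (singular_value W l - \<sigma> l)\<^sup>2"]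
    by (simp add: singular_value_eq[OF assms(3)])
  finally show ?thesis using sum_square_diff_singular_value_le by simp
qed

lemma svd_combination_dist:
  fixes Y :: "real^'n^'m"
  assumes svd: "is_svd Y \<sigma> u v" and s: "s \<le> num_sv TYPE(real^'n^'m)"
  shows "(norm ((\<Sum>l<s. p l *\<^sub>R outer_prod (u l) (v l)) - Y))\<^sup>2 =
    (\<Sum>l<s. (p l - \<sigma> l)\<^sup>2) + (\<Sum>l=s..<num_sv TYPE(real^'n^'m). (\<sigma> l)\<^sup>2)"
proof -
  let ?r = "num_sv TYPE(real^'n^'m)" and ?o = "\<lambda>l. outer_prod (u l) (v l)"
  define q where "q l = (if l < s then p l else 0)" for l
  have Y: "Y = (\<Sum>l<?r. \<sigma> l *\<^sub>R ?o l)" using svd by (simp add: is_svd_iff)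
  have "(\<Sum>l<s. p l *\<^sub>R ?o l) = (\<Sum>l<?r. q l *\<^sub>R ?o l)"
    by (rule sum.mono_neutral_cong_left) (use s in \<open>auto simp: q_def\<close>)
  then have "(\<Sum>l<s. p l *\<^sub>R ?o l) - Y = (\<Sum>l<?r. (q l - \<sigma> l) *\<^sub>R ?o l)"
    by (simp add: Y sum_subtractf scaleR_left_diff_distrib)
  moreover have "orthonormal_on {..<?r} ?o"
    using svd by (auto simp: is_svd_iff orthonormal_on_def inner_outer_prod_outer_prod)
  ultimately have "(norm ((\<Sum>l<s. p l *\<^sub>R ?o l) - Y))\<^sup>2 = (\<Sum>l<?r. (q l - \<sigma> l)\<^sup>2)"
    by (simp add: orthonormal_on_norm_sum)
  also have "\<dots> = (\<Sum>l<s. (q l - \<sigma> l)\<^sup>2) + (\<Sum>l=s..<?r. (q l - \<sigma> l)\<^sup>2)"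
    by (rule sum_lessThan_split[OF s])
  finally show ?thesis by (simp add: q_def)
qed

lemma eckart_young:
  fixes Y :: "real^'n^'m"
  assumes svd: "is_svd Y \<sigma> u v" and s: "s \<le> num_sv TYPE(real^'n^'m)"
  shows "is_arg_min (\<lambda>Z. dist Y Z) (\<lambda>Z. rank Z \<le> s) (\<Sum>l<s. \<sigma> l *\<^sub>R outer_prod (u l) (v l))"
  unfolding is_arg_min_linorder
proof (intro conjI allI impI)
  let ?P = "\<Sum>l<s. \<sigma> l *\<^sub>R outer_prod (u l) (v l)"
  show "rank ?P \<le> s" by (rule rank_sum_outer_prod_le)
  fix Z :: "real^'n^'m" assume Z: "rank Z \<le> s"
  have "(norm (?P - Y))\<^sup>2 = (\<Sum>l=s..<num_sv TYPE(real^'n^'m). (\<sigma> l)\<^sup>2)"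
    unfolding svd_combination_dist[OF svd s] by simp
  also have "\<dots> \<le> (\<Sum>l<s. (singular_value Z l - \<sigma> l)\<^sup>2) + (\<Sum>l=s..<num_sv TYPE(real^'n^'m). (\<sigma> l)\<^sup>2)"
    by (simp add: sum_nonneg)
  also have "\<dots> \<le> (norm (Z - Y))\<^sup>2" by (rule low_rank_dist_ge[OF Z s svd])
  finally have "norm (?P - Y) \<le> norm (Z - Y)" by (simp add: power2_le_iff_abs_le)
  then show "dist Y ?P \<le> dist Y Z" by (simp add: dist_norm norm_minus_commute)
qed

text \<open>Lagrangian duality with multiplier \<open>2 * \<tau>\<close> for the constraint on the
  sum. Soft-thresholding minimises the Lagrangian in each coordinate over nonnegative values, and
  the assumption for \<open>0 < \<tau>\<close> is complementary slackness.\<close>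

lemma soft_threshold_optimal:
  fixes \<sigma> w :: "'i \<Rightarrow> real"
  assumes "finite I" and w: "\<And>l. l \<in> I \<Longrightarrow> 0 \<le> w l" "(\<Sum>l\<in>I. w l) \<le> R"
    and \<tau>: "0 \<le> \<tau>" "0 < \<tau> \<Longrightarrow> (\<Sum>l\<in>I. max (\<sigma> l - \<tau>) 0) = R"
    and \<sigma>: "\<And>l. l \<in> I \<Longrightarrow> 0 \<le> \<sigma> l"
  shows "(\<Sum>l\<in>I. (max (\<sigma> l - \<tau>) 0 - \<sigma> l)\<^sup>2) \<le> (\<Sum>l\<in>I. (w l - \<sigma> l)\<^sup>2)"
proof -
  let ?p = "\<lambda>l. max (\<sigma> l - \<tau>) 0"
  have "(?p l - \<sigma> l)\<^sup>2 \<le> (w l - \<sigma> l)\<^sup>2 + 2 * \<tau> * (w l - ?p l)" if l: "l \<in> I" for l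
  proof (cases "\<tau> \<le> \<sigma> l")
    case True
    have "0 \<le> (w l - (\<sigma> l - \<tau>))\<^sup>2" by simp
    moreover have "?p l = \<sigma> l - \<tau>" using True by simp
    ultimately show ?thesis by (simp add: power2_eq_square algebra_simps)
  next
    case False
    have "0 \<le> (w l)\<^sup>2 + 2 * w l * (\<tau> - \<sigma> l)"
      using False w(1)[OF l] by simp
    then show ?thesis using False by (simp add: max_def power2_eq_square algebra_simps)
  qed
  then have "(\<Sum>l\<in>I. (?p l - \<sigma> l)\<^sup>2) \<le> (\<Sum>l\<in>I. (w l - \<sigma> l)\<^sup>2 + 2 * \<tau> * (w l - ?p l))"
    by (rule sum_mono)
  also have "\<dots> = (\<Sum>l\<in>I. (w l - \<sigma> l)\<^sup>2) + 2 * \<tau> * ((\<Sum>l\<in>I. w l) - (\<Sum>l\<in>I. ?p l))"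
    by (simp add: sum.distrib sum_distrib_left sum_subtractf right_diff_distrib)
  also have "\<dots> \<le> (\<Sum>l\<in>I. (w l - \<sigma> l)\<^sup>2)"
    using \<tau> w(2) by (cases "\<tau> = 0") (auto intro: mult_nonneg_nonpos)
  finally show ?thesis .
qed

lemma low_rank_ball_projection:
  fixes Y :: "real^'n^'m"
  assumes svd: "is_svd Y \<sigma> u v" and s: "s \<le> num_sv TYPE(real^'n^'m)"
    and \<tau>: "0 \<le> \<tau>" "(\<Sum>l<s. max (\<sigma> l - \<tau>) 0) \<le> R"
      "0 < \<tau> \<Longrightarrow> (\<Sum>l<s. max (\<sigma> l - \<tau>) 0) = R"
  shows "is_arg_min (\<lambda>W. (norm (W - Y))\<^sup>2) (\<lambda>W. W \<in> nuclear_ball R \<and> rank W \<le> s)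
    (\<Sum>l<s. max (\<sigma> l - \<tau>) 0 *\<^sub>R outer_prod (u l) (v l))"
  unfolding is_arg_min_linorder
proof (intro conjI allI impI)
  let ?r = "num_sv TYPE(real^'n^'m)"
  let ?P = "\<Sum>l<s. max (\<sigma> l - \<tau>) 0 *\<^sub>R outer_prod (u l) (v l)"
  have \<sigma>: "0 \<le> \<sigma> l" if "l < ?r" for l using svd that by (simp add: is_svd_iff)
  \<comment> \<open>Padding with zeros keeps the values nonnegative and decreasing, so
    \<open>q\<close>, \<open>u\<close>, \<open>v\<close> form a decomposition of \<open>?P\<close>
    and its nuclear norm can be read off.\<close>
  define q where "q l = (if l < s then max (\<sigma> l - \<tau>) 0 else 0)" for l
  have "?P = (\<Sum>l<?r. q l *\<^sub>R outer_prod (u l) (v l))"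
    by (rule sum.mono_neutral_cong_left) (use s in \<open>auto simp: q_def\<close>)
  moreover have "q l \<le> q k" if "k \<le> l" "l < ?r" for k l
  proof -
    have "\<sigma> l \<le> \<sigma> k" using svd that by (auto simp: is_svd_iff)
    then show ?thesis using that by (auto simp: q_def)
  qed
  ultimately have "is_svd ?P q u v"
    using svd by (auto simp: is_svd_iff q_def)
  then have "nuclear_norm ?P = (\<Sum>l<?r. q l)" by (rule nuclear_norm_svd)
  also have "\<dots> = (\<Sum>l<s. max (\<sigma> l - \<tau>) 0)"
    by (rule sum.mono_neutral_cong_right) (use s in \<open>auto simp: q_def\<close>)
  finally show "?P \<in> nuclear_ball R" using \<tau>(2) by (simp add: nuclear_ball_def)
  show "rank ?P \<le> s" by (rule rank_sum_outer_prod_le)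
  fix W :: "real^'n^'m" assume W: "W \<in> nuclear_ball R \<and> rank W \<le> s"
  have "(\<Sum>l<s. singular_value W l) \<le> nuclear_norm W"
    unfolding nuclear_norm_def using s by (intro sum_mono2) (auto intro: singular_value_nonneg)
  then have "(\<Sum>l<s. singular_value W l) \<le> R" using W by (simp add: nuclear_ball_def)
  then have "(\<Sum>l<s. (max (\<sigma> l - \<tau>) 0 - \<sigma> l)\<^sup>2) \<le> (\<Sum>l<s. (singular_value W l - \<sigma> l)\<^sup>2)"
    using s \<tau> \<sigma> by (intro soft_threshold_optimal) (auto intro!: singular_value_nonneg)
  then have "(norm (?P - Y))\<^sup>2 \<le>
      (\<Sum>l<s. (singular_value W l - \<sigma> l)\<^sup>2) + (\<Sum>l=s..<?r. (\<sigma> l)\<^sup>2)"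
    unfolding svd_combination_dist[OF svd s] by simp
  also have "\<dots> \<le> (norm (W - Y))\<^sup>2" using W by (intro low_rank_dist_ge[OF _ s svd]) simp
  finally show "(norm (?P - Y))\<^sup>2 \<le> (norm (W - Y))\<^sup>2" .
qed

section \<open>Orthogonality of the residual of a best low-rank approximation\<close>

lemma inner_matrix_mul_left:
  fixes A :: "real^'n^'m" and B :: "real^'k^'m" and C :: "real^'n^'k"
  shows "A \<bullet> (B ** C) = (A ** transpose C) \<bullet> B"
proof -
  have "A \<bullet> (B ** C) = (\<Sum>i\<in>UNIV. \<Sum>j\<in>UNIV. \<Sum>k\<in>UNIV. A $ i $ j * (B $ i $ k * C $ k $ j))"
    by (simp add: inner_vec_def matrix_matrix_mult_def sum_distrib_left)
  also have "\<dots> = (\<Sum>i\<in>UNIV. \<Sum>k\<in>UNIV. \<Sum>j\<in>UNIV. A $ i $ j * (B $ i $ k * C $ k $ j))"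
    by (intro sum.cong refl sum.swap)
  also have "\<dots> = (A ** transpose C) \<bullet> B"
    by (simp add: inner_vec_def matrix_matrix_mult_def transpose_def sum_distrib_left mult_ac)
  finally show ?thesis .
qed

lemma inner_transpose:
  fixes A B :: "real^'n^'m"
  shows "transpose A \<bullet> transpose B = A \<bullet> B"
proof -
  have "transpose A \<bullet> transpose B = (\<Sum>j\<in>UNIV. \<Sum>i\<in>UNIV. A $ i $ j * B $ i $ j)"
    by (simp add: inner_vec_def transpose_def)
  also have "\<dots> = A \<bullet> B" unfolding inner_vec_def by (subst sum.swap) (simp add: inner_vec_def)
  finally show ?thesis .
qed

lemma transpose_0: "transpose (0 :: real^'n^'m) = 0"
  by (simp add: transpose_def vec_eq_iff)

lemma norm_minimal_imp_orthogonal: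
  fixes E D :: "'a::real_inner"
  assumes "\<And>t. norm E \<le> norm (E - t *\<^sub>R D)"
  shows "E \<bullet> D = 0"
proof (cases "D = 0")
  case False
  define t where "t = (E \<bullet> D) / (D \<bullet> D)"
  have "(norm E)\<^sup>2 \<le> (norm (E - t *\<^sub>R D))\<^sup>2" using assms by (intro power_mono) auto
  also have "\<dots> = (norm E)\<^sup>2 - 2 * t * (E \<bullet> D) + t\<^sup>2 * (D \<bullet> D)"
    unfolding power2_norm_eq_inner
    by (simp add: inner_diff_left inner_diff_right inner_commute power2_eq_square algebra_simps)
  also have "\<dots> = (norm E)\<^sup>2 - (E \<bullet> D)\<^sup>2 / (D \<bullet> D)"
    using False by (simp add: t_def power2_eq_square field_simps)
  finally have "(E \<bullet> D)\<^sup>2 / (D \<bullet> D) \<le> 0" by simp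
  moreover have "0 < D \<bullet> D" using False by simp
  ultimately have "(E \<bullet> D)\<^sup>2 \<le> 0" by (simp only: divide_le_0_iff) auto
  then show ?thesis by simp
qed simp

lemma matrix_mul_add_left:
  fixes A B :: "real^'n^'m" and C :: "real^'k^'n"
  shows "(A + B) ** C = A ** C + B ** C"
  by (simp add: matrix_matrix_mult_def vec_eq_iff sum.distrib distrib_right)

lemma matrix_mul_scaleR_left:
  fixes A :: "real^'n^'m" and C :: "real^'k^'n"
  shows "(c *\<^sub>R A) ** C = c *\<^sub>R (A ** C)"
  by (simp add: matrix_matrix_mult_def vec_eq_iff sum_distrib_left mult.assoc)

lemma best_approx_residual_left:
  fixes X Z :: "real^'n^'m"
  assumes "\<And>W :: real^'n^'m. rank W \<le> rank Z \<Longrightarrow> dist X Z \<le> dist X W"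
  shows "(X - Z) ** transpose Z = 0"
proof -
  \<comment> \<open>Moving along \<open>B ** Z\<close> multiplies \<open>Z\<close> from the left by
    \<open>mat 1 + t *\<^sub>R B\<close>, which cannot raise the rank. This \<open>B\<close> makes
    the inner product of the residual with the direction equal to \<open>B \<bullet> B\<close>, so
    the first-order condition forces \<open>B = 0\<close>.\<close>
  define B where "B = (X - Z) ** transpose Z"
  have "norm (X - Z) \<le> norm ((X - Z) - t *\<^sub>R (B ** Z))" for t
  proof -
    have "Z + t *\<^sub>R (B ** Z) = (mat 1 + t *\<^sub>R B) ** Z"
      by (simp add: matrix_mul_add_left matrix_mul_scaleR_left)
    then have "rank (Z + t *\<^sub>R (B ** Z)) \<le> rank Z" by (metis rank_mul_le_right)
    from assms[OF this] show ?thesis by (simp add: dist_norm algebra_simps)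
  qed
  then have "(X - Z) \<bullet> (B ** Z) = 0" by (rule norm_minimal_imp_orthogonal)
  then have "B \<bullet> B = 0" unfolding inner_matrix_mul_left by (simp only: B_def)
  then show ?thesis by (simp add: B_def)
qed

text \<open>A best low-rank approximation cannot be improved by moving within its row or column space;
  hence the residual vanishes on both.\<close>

lemma best_approx_residual:
  fixes X Z :: "real^'n^'m"
  assumes "is_arg_min (\<lambda>Z. dist X Z) (\<lambda>Z. rank Z \<le> s) Z"
  shows "(X - Z) ** transpose Z = 0" "transpose (X - Z) ** Z = 0"
proof -
  have opt: "dist X Z \<le> dist X W" if "rank W \<le> rank Z" for W
    using assms that by (simp add: is_arg_min_linorder)
  then show "(X - Z) ** transpose Z = 0" by (rule best_approx_residual_left)
  have dt: "dist (transpose A) (transpose B) = dist A B" for A B :: "real^'n^'m"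
    using inner_transpose[of "A - B" "A - B"]
    by (simp add: dist_norm norm_eq_sqrt_inner transpose_def vec_eq_iff inner_vec_def)
  have "(transpose X - transpose Z) ** transpose (transpose Z) = 0"
  proof (rule best_approx_residual_left)
    fix W :: "real^'m^'n" assume "rank W \<le> rank (transpose Z)"
    then have "rank (transpose W) \<le> rank Z" by (simp add: rank_transpose)
    from opt[OF this] show "dist (transpose X) (transpose Z) \<le> dist (transpose X) W"
      by (metis dt transpose_transpose)
  qed
  moreover have "transpose X - transpose Z = transpose (X - Z)"
    by (simp add: transpose_def vec_eq_iff)
  ultimately show "transpose (X - Z) ** Z = 0" by simp
qed

text \<open>Test against the sum of the partial isometries of both polar decompositions, which is still a
  contraction because the supports are orthogonal.\<close>

lemma nuclear_norm_orthogonal_add: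
  fixes Z E :: "real^'n^'m"
  assumes 1: "E ** transpose Z = 0" and 2: "transpose E ** Z = 0"
  shows "nuclear_norm Z + nuclear_norm E \<le> nuclear_norm (Z + E)"
proof -
  let ?r = "num_sv TYPE(real^'n^'m)"
  let ?\<sigma> = "singular_value Z" and ?\<rho> = "singular_value E"
  obtain u v where Z: "is_svd Z ?\<sigma> u v" by (rule svd_singular_value)
  obtain a b where E: "is_svd E ?\<rho> a b" by (rule svd_singular_value)
  \<comment> \<open>Singular vectors for the value 0 are arbitrary and need not be orthogonal to
    those of the other matrix; only the nonzero values are kept, and they already carry the whole
    norm.\<close>
  define P where "P = {l. l < ?r \<and> ?\<sigma> l \<noteq> 0}"
  define Q where "Q = {l. l < ?r \<and> ?\<rho> l \<noteq> 0}"
  have PQ: "finite P" "finite Q" by (auto simp: P_def Q_def)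
  note oZ = svd_orthonormal[OF Z order_refl] and oE = svd_orthonormal[OF E order_refl]
  have EZ: "E *v (transpose Z *v x) = 0" for x
    by (simp add: matrix_vector_mul_assoc 1)
  have ZE': "transpose Z *v (E *v x) = 0" for x
  proof -
    have "transpose (transpose E ** Z) = transpose Z ** E" by (simp add: matrix_transpose_mul)
    then show ?thesis using 2 by (simp add: matrix_vector_mul_assoc transpose_0)
  qed
  have ZE: "Z *v (transpose E *v x) = 0" for x
  proof -
    have "transpose (E ** transpose Z) = Z ** transpose E" by (simp add: matrix_transpose_mul)
    then show ?thesis using 1 by (simp add: matrix_vector_mul_assoc transpose_0)
  qed
  have Ev: "E *v v l = 0" if "l \<in> P" for l
    using EZ[of "u l"] that by (auto simp: P_def svd_mult[OF Z] matrix_vector_mult_scaleR)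
  have Zb: "Z *v b l = 0" if "l \<in> Q" for l
    using ZE[of "a l"] that by (auto simp: Q_def svd_mult[OF E] matrix_vector_mult_scaleR)
  have ua: "u k \<bullet> a l = 0" if k: "k \<in> P" and l: "l \<in> Q" for k l
  proof -
    have "?\<rho> l *\<^sub>R (transpose Z *v a l) = transpose Z *v (E *v b l)"
      using l by (simp add: Q_def svd_mult[OF E] matrix_vector_mult_scaleR)
    then have "transpose Z *v a l = 0" using ZE' l by (simp add: Q_def)
    then have "(Z *v v k) \<bullet> a l = 0" by (metis inner_transpose_mult inner_zero_right)
    then show ?thesis using k by (auto simp: P_def svd_mult[OF Z])
  qed
  have vb: "v k \<bullet> b l = 0" if k: "k \<in> P" and l: "l \<in> Q" for k l
  proof -
    have "v k \<bullet> (transpose E *v a l) = 0" by (simp add: inner_transpose_mult Ev[OF k])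
    then show ?thesis using l by (auto simp: Q_def svd_mult[OF E])
  qed
  define x where "x = case_sum u a"
  define y where "y = case_sum v b"
  define W where "W = (\<Sum>i\<in>P <+> Q. 1 *\<^sub>R outer_prod (x i) (y i))"
  have x: "orthonormal_on (P <+> Q) x"
    unfolding x_def by (rule orthonormal_on_Plus[OF orthonormal_on_subset[OF oZ(1)]
          orthonormal_on_subset[OF oE(1)]]) (auto simp: ua P_def Q_def)
  have y: "orthonormal_on (P <+> Q) y"
    unfolding y_def by (rule orthonormal_on_Plus[OF orthonormal_on_subset[OF oZ(2)]
          orthonormal_on_subset[OF oE(2)]]) (auto simp: vb P_def Q_def)
  have "norm (W *v z) \<le> norm z" for z
  proof -
    have "(norm (W *v z))\<^sup>2 = (\<Sum>i\<in>P <+> Q. (y i \<bullet> z)\<^sup>2)"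
      unfolding W_def sum_outer_prod_vector_mult using orthonormal_on_norm_sum[OF _ x] PQ by simp
    also have "\<dots> \<le> (norm z)\<^sup>2" using bessel[OF _ y] PQ by simp
    finally show ?thesis by (simp add: power2_le_iff_abs_le)
  qed
  then have "W \<bullet> (Z + E) \<le> nuclear_norm (Z + E)" by (rule inner_contraction_le_nuclear_norm)
  moreover have "W \<bullet> (Z + E) = (\<Sum>i\<in>P <+> Q. x i \<bullet> ((Z + E) *v y i))"
    by (simp add: W_def inner_sum_left inner_outer_prod_left)
  moreover have "\<dots> = (\<Sum>l\<in>P. u l \<bullet> ((Z + E) *v v l)) + (\<Sum>l\<in>Q. a l \<bullet> ((Z + E) *v b l))"
    by (simp add: sum.Plus[OF PQ] x_def y_def)
  moreover have "(\<Sum>l\<in>P. u l \<bullet> ((Z + E) *v v l)) = (\<Sum>l\<in>P. ?\<sigma> l)"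
    by (rule sum.cong) (auto simp: matrix_vector_mult_add_rdistrib inner_add_right Ev svd_inner[OF Z] P_def)
  moreover have "(\<Sum>l\<in>Q. a l \<bullet> ((Z + E) *v b l)) = (\<Sum>l\<in>Q. ?\<rho> l)"
    by (rule sum.cong) (auto simp: matrix_vector_mult_add_rdistrib inner_add_right Zb svd_inner[OF E] Q_def)
  moreover have "(\<Sum>l\<in>P. ?\<sigma> l) = nuclear_norm Z"
    unfolding nuclear_norm_def by (rule sum.mono_neutral_left) (auto simp: P_def)
  moreover have "(\<Sum>l\<in>Q. ?\<rho> l) = nuclear_norm E"
    unfolding nuclear_norm_def by (rule sum.mono_neutral_left) (auto simp: Q_def)
  ultimately show ?thesis by simp
qed

lemma rank_diff_le:
  fixes A B :: "real^'n^'m"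
  shows "rank (A - B) \<le> rank A + rank B"
proof -
  let ?S = "range ((*v) A)" and ?T = "range ((*v) B)"
  have sub: "subspace ?S" "subspace ?T"
    by (auto intro!: linear_subspace_image matrix_vector_mul_linear)
  have "(A - B) *v x = A *v x + B *v (- x)" for x
    using matrix_vector_mult_scaleR[of B "-1" x] by (simp add: matrix_vector_mult_diff_rdistrib)
  then have "range ((*v) (A - B)) \<subseteq> {x + y |x y. x \<in> ?S \<and> y \<in> ?T}" by blast
  then have "rank (A - B) \<le> dim {x + y |x y. x \<in> ?S \<and> y \<in> ?T}"
    unfolding rank_dim_range by (rule dim_subset)
  also have "\<dots> \<le> rank A + rank B"
    using dim_sums_Int[OF sub] unfolding rank_dim_range by simp
  finally show ?thesis .
qed

text \<open>The 4 is the square of a triangle inequality: \<open>Z\<close> is at least as close to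
  \<open>X\<close> as \<open>W\<close> is. The 8 is this 4 times the rank bound \<open>2 * s\<close>
  of \<open>W - Z\<close>. For the second part, additivity and the assumption on the norms give
  \<open>nuclear_norm Z + nuclear_norm (X - Z) \<le> nuclear_norm W\<close>, and the triangle
  inequality cancels \<open>nuclear_norm Z\<close>.\<close>

lemma best_approx_bounds:
  fixes X Z W :: "real^'n^'m"
  assumes Z: "is_arg_min (\<lambda>Z. dist X Z) (\<lambda>Z. rank Z \<le> s) Z"
    and W: "rank W \<le> s" "nuclear_norm X \<le> nuclear_norm W"
  shows "(norm (W - Z))\<^sup>2 \<le> 4 * (norm (X - W))\<^sup>2"
    and "(nuclear_norm (X - Z))\<^sup>2 \<le> 8 * real s * (norm (X - W))\<^sup>2"
proof -
  have rZ: "rank Z \<le> s" and "dist X Z \<le> dist X W" using Z W by (auto simp: is_arg_min_linorder)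
  then have "norm (W - Z) \<le> 2 * norm (X - W)"
    using norm_triangle_ineq[of "W - X" "X - Z"] by (simp add: dist_norm norm_minus_commute)
  from power_mono[OF this norm_ge_zero, of 2]
  show WZ: "(norm (W - Z))\<^sup>2 \<le> 4 * (norm (X - W))\<^sup>2" by (simp add: power_mult_distrib)
  have "nuclear_norm (X - Z) \<le> nuclear_norm (W - Z)"
    using nuclear_norm_orthogonal_add[OF best_approx_residual[OF Z]]
      nuclear_norm_triangle[of "W - Z" Z] W(2) by simp
  from power_mono[OF this nuclear_norm_nonneg, of 2]
  have "(nuclear_norm (X - Z))\<^sup>2 \<le> (nuclear_norm (W - Z))\<^sup>2" .
  also have "\<dots> \<le> real (2 * s) * (norm (W - Z))\<^sup>2"
    using rank_diff_le[of W Z] rZ W by (intro nuclear_norm_square_le) simp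
  also have "\<dots> \<le> real (2 * s) * (4 * (norm (X - W))\<^sup>2)" by (intro mult_left_mono WZ) simp
  finally show "(nuclear_norm (X - Z))\<^sup>2 \<le> 8 * real s * (norm (X - W))\<^sup>2" by simp
qed

section \<open>Linear convergence\<close>

lemma gderiv_along_line:
  fixes f :: "'a::real_inner \<Rightarrow> real"
  assumes "\<And>X. GDERIV f X :> g X"
  shows "((\<lambda>t. f (X + t *\<^sub>R D)) has_real_derivative D \<bullet> g (X + t *\<^sub>R D)) (at t)"
proof -
  have "((\<lambda>t. X + t *\<^sub>R D) has_derivative (\<lambda>h. h *\<^sub>R D)) (at t)"
    by (auto intro!: derivative_eq_intros)
  from has_derivative_compose[OF this assms[unfolded gderiv_def]]
  have "((\<lambda>t. f (X + t *\<^sub>R D)) has_derivative (\<lambda>h. (h *\<^sub>R D) \<bullet> g (X + t *\<^sub>R D))) (at t)" .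
  then show ?thesis by (simp add: has_field_derivative_def mult.commute[of _ "D \<bullet> _"])
qed

lemma convex_gradient_inequality:
  fixes f :: "'a::real_inner \<Rightarrow> real"
  assumes "convex_on UNIV f" "\<And>X. GDERIV f X :> g X"
  shows "(Y - X) \<bullet> g X \<le> f Y - f X"
proof -
  have "convex_on UNIV (\<lambda>t. f (X + t *\<^sub>R (Y - X)))"
  proof (rule convex_onI)
    fix t a b :: real assume t: "0 < t" "t < 1"
    have "X + ((1 - t) *\<^sub>R a + t *\<^sub>R b) *\<^sub>R (Y - X) =
        (1 - t) *\<^sub>R (X + a *\<^sub>R (Y - X)) + t *\<^sub>R (X + b *\<^sub>R (Y - X))"
      by (simp add: algebra_simps)
    then show "f (X + ((1 - t) *\<^sub>R a + t *\<^sub>R b) *\<^sub>R (Y - X)) \<le>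
        (1 - t) * f (X + a *\<^sub>R (Y - X)) + t * f (X + b *\<^sub>R (Y - X))"
      using convex_onD[OF assms(1), of t] t by simp
  qed simp
  from convex_on_imp_above_tangent[OF this, of 0 1 "(Y - X) \<bullet> g X"]
    gderiv_along_line[OF assms(2), of X "Y - X" 0]
  show ?thesis by simp
qed

lemma segment_in_nuclear_ball:
  assumes "X \<in> nuclear_ball R" "V \<in> nuclear_ball R" "0 \<le> t" "t \<le> 1"
  shows "X + t *\<^sub>R (V - X) \<in> nuclear_ball R"
  using convexD_alt[OF convex_nuclear_ball assms] by (simp add: algebra_simps)

text \<open>Instead of integrating the gradient, the claimed bound is subtracted along the segment;
  duality and the Lipschitz condition make the derivative of the difference nonpositive. The segment
  stays in the ball, where that condition holds.\<close>

lemma nuclear_descent: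
  fixes f :: "real^'n^'m \<Rightarrow> real"
  assumes g: "\<And>X. GDERIV f X :> g X" and lip: "nuclear_lipschitz g R \<beta>"
    and X: "X \<in> nuclear_ball R" and V: "V \<in> nuclear_ball R" and \<gamma>: "0 \<le> \<gamma>" "\<gamma> \<le> 1"
  shows "f ((1 - \<gamma>) *\<^sub>R X + \<gamma> *\<^sub>R V) \<le>
    f X + \<gamma> * ((V - X) \<bullet> g X) + \<beta> / 2 * \<gamma>\<^sup>2 * (nuclear_norm (V - X))\<^sup>2"
proof -
  define D where "D = V - X"
  define \<phi> where "\<phi> t = f (X + t *\<^sub>R D) - t * (D \<bullet> g X) - \<beta> / 2 * t\<^sup>2 * (nuclear_norm D)\<^sup>2" for t
  have "\<phi> \<gamma> \<le> \<phi> 0"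
  proof (rule DERIV_nonpos_imp_nonincreasing[OF \<gamma>(1)])
    fix t assume t: "0 \<le> t" "t \<le> \<gamma>"
    have "(\<phi> has_real_derivative D \<bullet> g (X + t *\<^sub>R D) - D \<bullet> g X - \<beta> * t * (nuclear_norm D)\<^sup>2) (at t)"
      unfolding \<phi>_def
      by (auto intro!: derivative_eq_intros gderiv_along_line g)
    moreover have "D \<bullet> g (X + t *\<^sub>R D) - D \<bullet> g X \<le> \<beta> * t * (nuclear_norm D)\<^sup>2"
    proof -
      have "X + t *\<^sub>R D \<in> nuclear_ball R"
        unfolding D_def using X V t \<gamma> by (intro segment_in_nuclear_ball) auto
      then have "op_norm (g (X + t *\<^sub>R D) - g X) \<le> \<beta> * nuclear_norm (t *\<^sub>R D)"
        using lip X unfolding nuclear_lipschitz_def by (metis add_diff_cancel_left')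
      then have "nuclear_norm D * op_norm (g (X + t *\<^sub>R D) - g X) \<le> nuclear_norm D * (\<beta> * (t * nuclear_norm D))"
        using t by (intro mult_left_mono nuclear_norm_nonneg) (simp add: nuclear_norm_scaleR)
      moreover have "D \<bullet> g (X + t *\<^sub>R D) - D \<bullet> g X \<le> nuclear_norm D * op_norm (g (X + t *\<^sub>R D) - g X)"
        using inner_le_nuclear_norm_op_norm[of D "g (X + t *\<^sub>R D) - g X"] by (simp add: inner_diff_right)
      ultimately show ?thesis by (simp add: power2_eq_square mult_ac)
    qed
    ultimately show "\<exists>y. (\<phi> has_real_derivative y) (at t) \<and> y \<le> 0" by force
  qed
  moreover have "(1 - \<gamma>) *\<^sub>R X + \<gamma> *\<^sub>R V = X + \<gamma> *\<^sub>R D" by (simp add: D_def algebra_simps)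
  ultimately show ?thesis by (simp add: \<phi>_def D_def)
qed

lemma GDERIV_imp_continuous_on:
  assumes "\<And>X. GDERIV f X :> g X"
  shows "continuous_on A f"
  using assms unfolding gderiv_def by (intro has_derivative_continuous_on[where f' = "\<lambda>X h. h \<bullet> g X"])
    (auto intro: has_derivative_at_withinI)

lemma minimizers_nonempty:
  fixes f :: "real^'n^'m \<Rightarrow> real"
  assumes "0 \<le> R" "continuous_on UNIV f"
  shows "minimizers f R \<noteq> {}"
proof -
  have "(0 :: real^'n^'m) \<in> nuclear_ball R" using assms by (simp add: nuclear_ball_def nuclear_norm_0)
  then obtain X where "X \<in> nuclear_ball R" "\<forall>Y \<in> nuclear_ball R. f X \<le> f Y"
    using continuous_attains_inf[OF compact_nuclear_ball _ continuous_on_subset[OF assms(2) subset_UNIV]]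
    by blast
  then show ?thesis by (auto simp: minimizers_def is_arg_min_linorder)
qed

lemma opt_value_eq:
  assumes "Xs \<in> minimizers f R"
  shows "opt_value f R = f Xs"
  unfolding opt_value_def
  using assms by (intro cInf_eq_minimum) (auto simp: minimizers_def is_arg_min_linorder)

section \<open>Contraction of the error and the iteration count\<close>

locale low_rank_problem =
  fixes f :: "real^'n^'m \<Rightarrow> real" and g R s \<beta> \<alpha>
  assumes f_convex: "convex_on UNIV f" and gradient: "\<And>X. GDERIV f X :> g X"
    and R_pos: "0 < R" and \<beta>_pos: "0 < \<beta>" and lipschitz: "nuclear_lipschitz g R \<beta>"
    and \<alpha>_pos: "0 < \<alpha>" and growth: "quadratic_growth f R \<alpha>" and s_pos: "0 < s"
    and minimizer_rank: "\<And>Xs. Xs \<in> minimizers f R \<Longrightarrow> rank Xs \<le> s"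
    and minimizer_norm: "\<And>Xs. Xs \<in> minimizers f R \<Longrightarrow> nuclear_norm Xs = R"
    and step_01: "step_param s \<beta> \<alpha> \<in> {0..1}"
begin

abbreviation "\<eta> \<equiv> step_param s \<beta> \<alpha>"

lemma \<eta>_pos: "0 < \<eta>"
  using \<alpha>_pos \<beta>_pos s_pos by (simp add: step_param_def)

lemma minimizer_exists: "minimizers f R \<noteq> {}"
  using R_pos GDERIV_imp_continuous_on[OF gradient] by (intro minimizers_nonempty) auto

lemma opt_value_le: "X \<in> nuclear_ball R \<Longrightarrow> opt_value f R \<le> f X"
  using minimizer_exists opt_value_eq[of _ f R] by (force simp: minimizers_def is_arg_min_linorder)

lemma step_bound_wrt_minimizer:
  assumes X: "X \<in> nuclear_ball R" and Xs: "Xs \<in> minimizers f R"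
    and Z: "is_arg_min (\<lambda>Z. dist X Z) (\<lambda>Z. rank Z \<le> s) Z"
    and V: "is_arg_min (\<lambda>W. (W - X) \<bullet> g X + 2 * real s * \<beta> * \<eta> * (norm (W - Z))\<^sup>2)
          (\<lambda>W. W \<in> nuclear_ball R \<and> rank W \<le> s) V"
  shows "f ((1 - \<eta>) *\<^sub>R X + \<eta> *\<^sub>R V) - opt_value f R \<le>
    (1 - \<eta>) * (f X - opt_value f R) + 16 * s * \<beta> * \<eta>\<^sup>2 * (norm (X - Xs))\<^sup>2"
proof -
  have opt: "opt_value f R = f Xs" by (rule opt_value_eq[OF Xs])
  have Xs_ball: "Xs \<in> nuclear_ball R" using Xs by (simp add: minimizers_def is_arg_min_linorder)
  have "nuclear_norm X \<le> nuclear_norm Xs"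
    using X minimizer_norm[OF Xs] by (simp add: nuclear_ball_def)
  note bounds = best_approx_bounds[OF Z minimizer_rank[OF Xs] this]
  have V': "V \<in> nuclear_ball R" "rank V \<le> s" and rZ: "rank Z \<le> s"
    using V Z by (auto simp: is_arg_min_linorder)
  \<comment> \<open>The rank assumption makes \<open>Xs\<close> itself a competitor in the nonconvex
    subproblem.\<close>
  have min: "(V - X) \<bullet> g X + 2 * s * \<beta> * \<eta> * (norm (V - Z))\<^sup>2 \<le>
      (Xs - X) \<bullet> g X + 2 * s * \<beta> * \<eta> * (norm (Xs - Z))\<^sup>2"
    using V Xs_ball minimizer_rank[OF Xs] by (simp add: is_arg_min_linorder)
  have VZ: "(nuclear_norm (V - Z))\<^sup>2 \<le> real (2 * s) * (norm (V - Z))\<^sup>2"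
    using rank_diff_le[of V Z] V' rZ by (intro nuclear_norm_square_le) simp
  have "nuclear_norm (V - X) \<le> nuclear_norm (V - Z) + nuclear_norm (X - Z)"
    using nuclear_norm_triangle[of "V - Z" "Z - X"] nuclear_norm_minus[of "X - Z"] by simp
  then have "(nuclear_norm (V - X))\<^sup>2 \<le> (nuclear_norm (V - Z) + nuclear_norm (X - Z))\<^sup>2"
    by (rule power_mono) (rule nuclear_norm_nonneg)
  also have "\<dots> \<le> 2 * (nuclear_norm (V - Z))\<^sup>2 + 2 * (nuclear_norm (X - Z))\<^sup>2"
    using sum_squares_bound[of "nuclear_norm (V - Z)" "nuclear_norm (X - Z)"] by (simp add: power2_sum)
  also have "\<dots> \<le> 4 * s * (norm (V - Z))\<^sup>2 + 16 * s * (norm (X - Xs))\<^sup>2"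
    using VZ bounds(2) by simp
  finally have VX: "(nuclear_norm (V - X))\<^sup>2 \<le> 4 * s * (norm (V - Z))\<^sup>2 + 16 * s * (norm (X - Xs))\<^sup>2" .
  have "f ((1 - \<eta>) *\<^sub>R X + \<eta> *\<^sub>R V) \<le>
      f X + \<eta> * ((V - X) \<bullet> g X) + \<beta> / 2 * \<eta>\<^sup>2 * (nuclear_norm (V - X))\<^sup>2"
    using step_01 by (intro nuclear_descent[OF gradient lipschitz X V'(1)]) auto
  also have "\<dots> \<le> f X + \<eta> * ((V - X) \<bullet> g X) +
      \<beta> / 2 * \<eta>\<^sup>2 * (4 * s * (norm (V - Z))\<^sup>2 + 16 * s * (norm (X - Xs))\<^sup>2)"
    using \<beta>_pos by (intro add_left_mono mult_left_mono VX) auto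
  \<comment> \<open>Since \<open>\<beta> / 2 * \<eta>\<^sup>2 * 4 * s = \<eta> * (2 * s * \<beta> *
    \<eta>)\<close>, the part that depends on \<open>V\<close> is exactly \<open>\<eta>\<close>
    times the objective that \<open>V\<close> minimises.\<close>
  also have "\<dots> = f X + \<eta> * ((V - X) \<bullet> g X + 2 * s * \<beta> * \<eta> * (norm (V - Z))\<^sup>2) +
      8 * s * \<beta> * \<eta>\<^sup>2 * (norm (X - Xs))\<^sup>2"
    by (simp add: power2_eq_square algebra_simps)
  also have "\<dots> \<le> f X + \<eta> * ((Xs - X) \<bullet> g X + 2 * s * \<beta> * \<eta> * (norm (Xs - Z))\<^sup>2) +
      8 * s * \<beta> * \<eta>\<^sup>2 * (norm (X - Xs))\<^sup>2"
    using \<eta>_pos by (intro add_left_mono add_right_mono mult_left_mono min) auto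
  also have "\<dots> \<le> f X + \<eta> * ((f Xs - f X) + 2 * s * \<beta> * \<eta> * (4 * (norm (X - Xs))\<^sup>2)) +
      8 * s * \<beta> * \<eta>\<^sup>2 * (norm (X - Xs))\<^sup>2"
    using \<eta>_pos \<beta>_pos
    by (intro add_left_mono add_right_mono mult_left_mono add_mono
        convex_gradient_inequality[OF f_convex gradient] bounds(1)) auto
  \<comment> \<open>The 16 collects 8 from the residual \<open>X - Z\<close> and
    \<open>2 * 4\<close> from the penalty at \<open>Xs\<close>.\<close>
  also have "\<dots> = f Xs + (1 - \<eta>) * (f X - f Xs) + 16 * s * \<beta> * \<eta>\<^sup>2 * (norm (X - Xs))\<^sup>2"
    by (simp add: power2_eq_square algebra_simps)
  finally show ?thesis by (simp add: opt)
qed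

lemma step_contraction:
  assumes X: "X \<in> nuclear_ball R" and step: "fw_step f g R s \<beta> \<eta> rule X X'"
  shows "X' \<in> nuclear_ball R" "f X' - opt_value f R \<le> (1 - \<eta> / 2) * (f X - opt_value f R)"
proof -
  obtain Z V \<gamma> where Z: "is_arg_min (\<lambda>Z. dist X Z) (\<lambda>Z. rank Z \<le> s) Z"
    and V: "is_arg_min (\<lambda>W. (W - X) \<bullet> g X + 2 * real s * \<beta> * \<eta> * (norm (W - Z))\<^sup>2)
          (\<lambda>W. W \<in> nuclear_ball R \<and> rank W \<le> s) V"
    and \<gamma>: "case rule of
           Line_Search \<Rightarrow> is_arg_min (\<lambda>\<delta>. f ((1 - \<delta>) *\<^sub>R X + \<delta> *\<^sub>R V)) (\<lambda>\<delta>. \<delta> \<in> {0..1}) \<gamma>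
         | Predefined \<Rightarrow> \<gamma> = \<eta>"
    and X': "X' = (1 - \<gamma>) *\<^sub>R X + \<gamma> *\<^sub>R V"
    using step unfolding fw_step_def by blast
  have VB: "V \<in> nuclear_ball R" using V by (simp add: is_arg_min_linorder)
  \<comment> \<open>Since \<open>\<eta>\<close> lies in the unit interval, line search does at least
    as well as the predefined step, so one estimate covers both rules.\<close>
  have \<gamma>': "\<gamma> \<in> {0..1}" "f X' \<le> f ((1 - \<eta>) *\<^sub>R X + \<eta> *\<^sub>R V)"
    using \<gamma> step_01 by (auto simp: X' is_arg_min_linorder split: step_rule.splits)
  show "X' \<in> nuclear_ball R"
    unfolding X' using \<gamma>'(1) by (intro convexD_alt[OF convex_nuclear_ball X VB]) auto
  define h where "h = f X - opt_value f R"
  define c where "c = 16 * real s * \<beta> * \<eta>\<^sup>2"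
  have c: "0 < c" using s_pos \<beta>_pos \<eta>_pos by (simp add: c_def)
  \<comment> \<open>Quadratic growth bounds an infimum. Solving the previous estimate for the
    squared distance gives a lower bound valid for all minimizers, which passes to the infimum
    without selecting a nearest one.\<close>
  have "(f X' - opt_value f R - (1 - \<eta>) * h) / c \<le> (INF Xs\<in>minimizers f R. (norm (X - Xs))\<^sup>2)"
  proof (rule cINF_greatest[OF minimizer_exists])
    fix Xs assume "Xs \<in> minimizers f R"
    from step_bound_wrt_minimizer[OF X this Z V] \<gamma>'(2) c
    show "(f X' - opt_value f R - (1 - \<eta>) * h) / c \<le> (norm (X - Xs))\<^sup>2"
      by (simp add: h_def c_def divide_le_eq mult.commute)
  qed
  also have "\<dots> \<le> 2 / \<alpha> * h" using growth X by (simp add: quadratic_growth_def h_def)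
  finally have "f X' - opt_value f R \<le> (1 - \<eta>) * h + c * (2 / \<alpha> * h)"
    using c by (simp add: divide_le_eq mult.commute)
  \<comment> \<open>Here the 64 in the step size is used: \<open>c * 2 / \<alpha> = 32 * s * \<beta>
    * \<eta>\<^sup>2 / \<alpha>\<close>, which is \<open>\<eta> / 2\<close> for
    \<open>\<eta> = \<alpha> / (64 * \<beta> * s)\<close>.\<close>
  also have "c * (2 / \<alpha> * h) = \<eta> / 2 * h"
    using s_pos \<beta>_pos \<alpha>_pos by (simp add: c_def step_param_def power2_eq_square)
  also have "(1 - \<eta>) * h + \<eta> / 2 * h = (1 - \<eta> / 2) * h" by (simp add: field_simps)
  finally show "f X' - opt_value f R \<le> (1 - \<eta> / 2) * (f X - opt_value f R)"
    by (simp add: h_def)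
qed

lemma run_linear_convergence:
  assumes "fw_run f g R s \<beta> \<alpha> rule X"
  shows "linear_iteration_bound f R s \<beta> \<alpha> X"
  unfolding linear_iteration_bound_def approx_solution_def
proof (intro allI impI)
  fix \<epsilon> :: real and k :: nat
  assume \<epsilon>: "0 < \<epsilon>"
    and k: "128 * (\<beta> * real s / \<alpha>) * ln ((f (X 1) - opt_value f R) / \<epsilon>) \<le> real k"
  have \<eta>2: "0 \<le> 1 - \<eta> / 2" using step_01 by simp
  \<comment> \<open>Numbering starts at 1, so \<open>X (Suc k)\<close> is the iterate after
    \<open>k\<close> steps.\<close>
  have run: "X (Suc k) \<in> nuclear_ball R \<and>
      f (X (Suc k)) - opt_value f R \<le> (1 - \<eta> / 2) ^ k * (f (X 1) - opt_value f R)" for k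
  proof (induction k)
    case 0
    then show ?case using assms by (simp add: fw_run_def)
  next
    case (Suc k)
    have "fw_step f g R s \<beta> \<eta> (rule (Suc k)) (X (Suc k)) (X (Suc (Suc k)))"
      using assms by (simp add: fw_run_def)
    with Suc have *: "X (Suc (Suc k)) \<in> nuclear_ball R"
      "f (X (Suc (Suc k))) - opt_value f R \<le> (1 - \<eta> / 2) * (f (X (Suc k)) - opt_value f R)"
      using step_contraction by blast+
    note *(2)
    also have "(1 - \<eta> / 2) * (f (X (Suc k)) - opt_value f R) \<le>
        (1 - \<eta> / 2) * ((1 - \<eta> / 2) ^ k * (f (X 1) - opt_value f R))"
      using Suc \<eta>2 by (intro mult_left_mono) auto
    finally show ?case using * by (simp add: mult.assoc)
  qed
  have "f (X (k + 1)) - opt_value f R \<le> \<epsilon>"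
  \<comment> \<open>If \<open>X 1\<close> is optimal the logarithm carries no information, but
    contraction keeps the error at 0.\<close>
  proof (cases "f (X 1) - opt_value f R = 0")
    case True
    then show ?thesis using run[of k] \<epsilon> by simp
  next
    case False
    then have h: "0 < f (X 1) - opt_value f R"
      using opt_value_le[of "X 1"] assms by (simp add: fw_run_def)
    have "(1 - \<eta> / 2) ^ k \<le> exp (- (\<eta> / 2)) ^ k"
      using exp_ge_add_one_self[of "- (\<eta> / 2)"] by (intro power_mono \<eta>2) simp
    also have "\<dots> = exp (- (\<eta> / 2) * k)" by (simp add: exp_of_nat_mult[symmetric] mult.commute)
    also have "\<dots> \<le> exp (- ln ((f (X 1) - opt_value f R) / \<epsilon>))"
    proof -
      \<comment> \<open>The constant 128 is twice 64: \<open>\<eta> / 2\<close> is the reciprocal of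
        \<open>128 * \<beta> * s / \<alpha>\<close>.\<close>
      have "\<eta> / 2 * (128 * (\<beta> * real s / \<alpha>) * ln ((f (X 1) - opt_value f R) / \<epsilon>)) \<le> \<eta> / 2 * k"
        using \<eta>_pos by (intro mult_left_mono k) simp
      then show ?thesis using \<alpha>_pos \<beta>_pos s_pos by (simp add: step_param_def)
    qed
    also have "\<dots> = \<epsilon> / (f (X 1) - opt_value f R)"
      using h \<epsilon> by (simp add: exp_minus)
    finally have "(1 - \<eta> / 2) ^ k * (f (X 1) - opt_value f R) \<le> \<epsilon>"
      using h by (simp add: le_divide_eq)
    then show ?thesis using run[of k] by simp
  qed
  then show "X (k + 1) \<in> nuclear_ball R \<and> f (X (k + 1)) - opt_value f R \<le> \<epsilon>"
    using run[of k] by simp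
qed

end

section \<open>The threshold of the simplex projection\<close>

text \<open>The projection subtracts the \<open>\<tau>\<close> for which the positive parts of \<open>\<sigma> l - \<tau>\<close> sum to \<open>R\<close>. If the
  first \<open>k\<close> entries are the active ones, then \<open>\<tau> = ((\<Sum>l<k. \<sigma> l) - R) / k\<close>, and no other \<open>k\<close> gives a
  larger value, so that a running maximum finds \<open>\<tau>\<close> without searching for \<open>k\<close>.\<close>

primrec threshold :: "real \<Rightarrow> (nat \<Rightarrow> real) \<Rightarrow> nat \<Rightarrow> real" where
  "threshold R \<sigma> 0 = 0"
| "threshold R \<sigma> (Suc n) = max (threshold R \<sigma> n) (((\<Sum>l<Suc n. \<sigma> l) - R) / real (Suc n))"

lemma threshold_nonneg: "0 \<le> threshold R \<sigma> n"
  by (induction n) auto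

lemma threshold_ge: "0 < k \<Longrightarrow> k \<le> n \<Longrightarrow> ((\<Sum>l<k. \<sigma> l) - R) / real k \<le> threshold R \<sigma> n"
  by (induction n) (auto simp: le_Suc_eq)

lemma threshold_attained:
  "threshold R \<sigma> n = 0 \<or> (\<exists>k. 0 < k \<and> k \<le> n \<and> threshold R \<sigma> n = ((\<Sum>l<k. \<sigma> l) - R) / real k)"
proof (induction n)
  case (Suc n)
  show ?case
  proof (cases "((\<Sum>l<Suc n. \<sigma> l) - R) / real (Suc n) \<le> threshold R \<sigma> n")
    case True
    then have "threshold R \<sigma> (Suc n) = threshold R \<sigma> n" by simp
    with Suc show ?thesis by (metis le_SucI)
  next
    case False
    then have "threshold R \<sigma> (Suc n) = ((\<Sum>l<Suc n. \<sigma> l) - R) / real (Suc n)" by simp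
    then show ?thesis by blast
  qed
qed simp

lemma threshold_sum_le:
  assumes "0 < R" and dec: "\<And>k l. k \<le> l \<Longrightarrow> l < n \<Longrightarrow> \<sigma> l \<le> \<sigma> k"
  shows "(\<Sum>l<n. max (\<sigma> l - threshold R \<sigma> n) 0) \<le> R"
proof -
  let ?\<tau> = "threshold R \<sigma> n"
  \<comment> \<open>As \<open>\<sigma>\<close> decreases, the active indices form an initial
    segment, so their number determines them. Then \<open>threshold_ge\<close> at this
    \<open>k\<close> is the claim after clearing the denominator.\<close>
  define k where "k = card {l. l < n \<and> ?\<tau> < \<sigma> l}"
  have "{l. l < n \<and> ?\<tau> < \<sigma> l} = {..<k}"
  proof -
    let ?A = "{l. l < n \<and> ?\<tau> < \<sigma> l}"
    have down: "i \<in> ?A" if "j \<in> ?A" "i \<le> j" for i j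
      using that dec[of i j] by auto
    have "?A \<subseteq> {..<k}"
    proof
      fix j assume "j \<in> ?A"
      then have "{..j} \<subseteq> ?A" using down by blast
      then have "card {..j} \<le> k" unfolding k_def by (intro card_mono) auto
      then show "j \<in> {..<k}" by simp
    qed
    moreover have "card ?A = card {..<k}" by (simp add: k_def)
    ultimately show ?thesis by (intro card_subset_eq) auto
  qed
  then have A: "l < n \<and> ?\<tau> < \<sigma> l \<longleftrightarrow> l < k" for l by auto
  have kn: "k \<le> n" using A by (metis leI lessThan_iff less_irrefl)
  have "(\<Sum>l<n. max (\<sigma> l - ?\<tau>) 0) = (\<Sum>l<k. \<sigma> l - ?\<tau>)"
  proof (rule sum.mono_neutral_cong_right)
    show "\<forall>i\<in>{..<n} - {..<k}. max (\<sigma> i - ?\<tau>) 0 = 0"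
    proof
      fix i assume "i \<in> {..<n} - {..<k}"
      then show "max (\<sigma> i - ?\<tau>) 0 = 0" using A[of i] by simp
    qed
    show "max (\<sigma> l - ?\<tau>) 0 = \<sigma> l - ?\<tau>" if "l \<in> {..<k}" for l using A[of l] that by simp
  qed (use kn in auto)
  also have "\<dots> = (\<Sum>l<k. \<sigma> l) - k * ?\<tau>" by (simp add: sum_subtractf)
  also have "\<dots> \<le> R"
  proof (cases "k = 0")
    case False
    then show ?thesis using threshold_ge[of k n \<sigma> R] kn by (simp add: divide_le_eq mult.commute)
  qed (use assms(1) in simp)
  finally show ?thesis .
qed

text \<open>A positive threshold is attained at some \<open>k\<close>, so \<open>R\<close> is the
  sum of \<open>\<sigma> l - ?\<tau>\<close> over \<open>l < k\<close>. This \<open>k\<close> need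
  not be the number of active entries, because positive parts only increase the sum.\<close>

lemma threshold_sum_eq:
  assumes "0 < R" "\<And>k l. k \<le> l \<Longrightarrow> l < n \<Longrightarrow> \<sigma> l \<le> \<sigma> k" "0 < threshold R \<sigma> n"
  shows "(\<Sum>l<n. max (\<sigma> l - threshold R \<sigma> n) 0) = R"
proof (rule antisym[OF threshold_sum_le[OF assms(1,2)]])
  let ?\<tau> = "threshold R \<sigma> n"
  obtain k where k: "0 < k" "k \<le> n" "?\<tau> = ((\<Sum>l<k. \<sigma> l) - R) / real k"
    using threshold_attained[of R \<sigma> n] assms(3) by auto
  then have "R = (\<Sum>l<k. \<sigma> l - ?\<tau>)" by (simp add: sum_subtractf)
  also have "\<dots> \<le> (\<Sum>l<k. max (\<sigma> l - ?\<tau>) 0)" by (intro sum_mono) simp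
  also have "\<dots> \<le> (\<Sum>l<n. max (\<sigma> l - ?\<tau>) 0)" using k by (intro sum_mono2) auto
  finally show "R \<le> (\<Sum>l<n. max (\<sigma> l - ?\<tau>) 0)" .
qed

section \<open>The implementation\<close>

text \<open>Matrix registers: 0 is the iterate, 1 its truncation, 2 the gradient, 3 the point to be projected,
  4 the result of the projection. Scalars 3, 4 and 6 are scratch; Scalar 5 holds first the threshold
  and then the step size.\<close>

definition block :: "('m, 'n) prog list \<Rightarrow> ('m, 'n) prog" where
  "block ps = foldr Seq ps Skip"

lemma exec_block [simp]:
  "exec s S (block []) \<mu> = \<mu>"
  "exec s S (block (p # ps)) \<mu> = exec s S (block ps) (exec s S p \<mu>)"
  by (simp_all add: block_def)

lemma exec_block_append [simp]:
  "exec s S (block (ps @ qs)) \<mu> = exec s S (block qs) (exec s S (block ps) \<mu>)"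
  by (induction ps arbitrary: \<mu>) auto

text \<open>The bound is uniform in the memory, so costs add along a sequence without tracking
  states, and it excludes subroutine calls altogether.\<close>

definition arithmetic_cost_le ::
  "nat \<Rightarrow> ('m::finite, 'n::finite) subroutines \<Rightarrow> ('m, 'n) prog \<Rightarrow> nat \<Rightarrow> bool" where
  "arithmetic_cost_le s S p K \<longleftrightarrow>
     (\<forall>\<mu> r. cost s S p \<mu> r \<le> (if r = Elementary then K else 0))"

lemma arithmetic_cost_leD:
  "arithmetic_cost_le s S p K \<Longrightarrow> cost s S p \<mu> Elementary \<le> K"
  "arithmetic_cost_le s S p K \<Longrightarrow> r \<noteq> Elementary \<Longrightarrow> cost s S p \<mu> r = 0"
  unfolding arithmetic_cost_le_def by (metis, metis le_zero_eq)

lemma arithmetic_cost_le_Do: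
  "resource_of i = Elementary \<Longrightarrow> arithmetic_cost_le s S (Do i) 1"
  by (simp add: arithmetic_cost_le_def)

lemma arithmetic_cost_le_block_Nil: "arithmetic_cost_le s S (block []) 0"
  by (simp add: arithmetic_cost_le_def block_def)

lemma arithmetic_cost_le_block_Cons:
  "arithmetic_cost_le s S p K \<Longrightarrow> arithmetic_cost_le s S (block ps) L \<Longrightarrow>
    arithmetic_cost_le s S (block (p # ps)) (K + L)"
  by (fastforce simp: arithmetic_cost_le_def block_def intro: add_mono split: if_splits)

lemma arithmetic_cost_le_If_le:
  "arithmetic_cost_le s S p K \<Longrightarrow> arithmetic_cost_le s S q K \<Longrightarrow>
    arithmetic_cost_le s S (If_le a b p q) (Suc K)"
  by (fastforce simp: arithmetic_cost_le_def split: if_splits)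

lemma arithmetic_cost_le_block_map:
  "(\<And>x. x \<in> set xs \<Longrightarrow> arithmetic_cost_le s S (body x) K) \<Longrightarrow>
    arithmetic_cost_le s S (block (map body xs)) (length xs * K)"
  by (induction xs) (auto intro: arithmetic_cost_le_block_Nil arithmetic_cost_le_block_Cons)

lemma arithmetic_cost_le_mono:
  assumes "arithmetic_cost_le s S p K" "K \<le> L"
  shows "arithmetic_cost_le s S p L"
  unfolding arithmetic_cost_le_def
proof (intro allI)
  fix \<mu> r
  show "cost s S p \<mu> r \<le> (if r = Elementary then L else 0)"
    using arithmetic_cost_leD(1)[OF assms(1), of \<mu>] arithmetic_cost_leD(2)[OF assms(1), of r \<mu>] assms(2)
    by simp
qed

lemmas arithmetic_cost_intros = arithmetic_cost_le_Do arithmetic_cost_le_If_le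
  arithmetic_cost_le_block_Nil arithmetic_cost_le_block_Cons arithmetic_cost_le_block_map

text \<open>Any enumeration without repetitions serves: each pair of indices must be visited once,
  in whatever order.\<close>

definition indices :: "'a::finite list" where
  "indices = (SOME xs. distinct xs \<and> set xs = UNIV)"

lemma indices: "distinct (indices :: 'a::finite list)" "set (indices :: 'a list) = UNIV"
  using someI_ex[of "\<lambda>xs :: 'a list. distinct xs \<and> set xs = UNIV"] finite_distinct_list[of "UNIV :: 'a set"]
  by (auto simp: indices_def)

lemma length_indices: "length (indices :: 'a::finite list) = CARD('a)"
  using distinct_card[OF indices(1)[where 'a = 'a]] by (simp add: indices(2))

definition for_entries :: "('m::finite \<Rightarrow> 'n::finite \<Rightarrow> ('m, 'n) prog) \<Rightarrow> ('m, 'n) prog" where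
  "for_entries body = block (map (\<lambda>(i, j). body i j) (List.product indices indices))"

text \<open>The passes are independent. A pass writes only its own entry and the scratch cells
  \<open>T\<close>, and its result \<open>F i j\<close> reads neither scratch nor other entries of
  register \<open>k\<close>. It may read its own entry, which in-place updates need.\<close>

lemma exec_for_entries:
  fixes body :: "'m::finite \<Rightarrow> 'n::finite \<Rightarrow> ('m, 'n) prog"
  assumes F: "\<And>i j \<mu>. exec s S (body i j) \<mu> (Entry k i j) = F i j \<mu>"
    and frame: "\<And>i j \<mu> c. c \<noteq> Entry k i j \<Longrightarrow> c \<notin> T \<Longrightarrow> exec s S (body i j) \<mu> c = \<mu> c"
    and local: "\<And>i j \<mu> \<nu>. (\<forall>c. c \<notin> T \<and> (\<forall>i' j'. c = Entry k i' j' \<longrightarrow> i' = i \<and> j' = j) \<longrightarrow> \<mu> c = \<nu> c)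
      \<Longrightarrow> F i j \<mu> = F i j \<nu>"
    and T: "\<And>i j. Entry k i j \<notin> T"
  shows "matrix_at (exec s S (for_entries body) \<mu>) k = (\<chi> i j. F i j \<mu>)"
    and "c \<notin> T \<Longrightarrow> (\<And>i j. c \<noteq> Entry k i j) \<Longrightarrow> exec s S (for_entries body) \<mu> c = \<mu> c"
proof -
  have *: "(\<forall>(i, j)\<in>set ps. exec s S (block (map (\<lambda>(i, j). body i j) ps)) \<mu> (Entry k i j) = F i j \<mu>) \<and>
      (\<forall>c. c \<notin> T \<longrightarrow> (\<forall>(i, j)\<in>set ps. c \<noteq> Entry k i j) \<longrightarrow>
        exec s S (block (map (\<lambda>(i, j). body i j) ps)) \<mu> c = \<mu> c)"
    if "distinct ps" for ps :: "('m \<times> 'n) list" and \<mu>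
    using that
  proof (induction ps arbitrary: \<mu>)
    case (Cons p ps)
    obtain a b where p: "p = (a, b)" by (cases p)
    let ?\<nu> = "exec s S (body a b) \<mu>"
    have ab: "(a, b) \<notin> set ps" using Cons.prems p by simp
    have IH: "exec s S (block (map (\<lambda>(i, j). body i j) ps)) ?\<nu> (Entry k i j) = F i j ?\<nu>"
      if "(i, j) \<in> set ps" for i j using Cons that by auto
    have IH': "exec s S (block (map (\<lambda>(i, j). body i j) ps)) ?\<nu> c = ?\<nu> c"
      if "c \<notin> T" "\<forall>(i, j)\<in>set ps. c \<noteq> Entry k i j" for c using Cons that by simp
    have "F i j ?\<nu> = F i j \<mu>" if "(i, j) \<in> set ps" for i j
      using that ab by (intro local allI impI frame) auto
    moreover have "exec s S (block (map (\<lambda>(i, j). body i j) ps)) ?\<nu> (Entry k a b) = F a b \<mu>"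
      by (subst IH') (use ab T in \<open>auto simp: F\<close>)
    ultimately show ?case using IH IH' frame by (auto simp: p)
  qed simp
  have "distinct (List.product indices indices :: ('m \<times> 'n) list)"
    by (simp add: distinct_product indices)
  note * = *[OF this, of \<mu>, folded for_entries_def]
  show "matrix_at (exec s S (for_entries body) \<mu>) k = (\<chi> i j. F i j \<mu>)"
    using * by (simp add: matrix_at_def vec_eq_iff indices)
  show "exec s S (for_entries body) \<mu> c = \<mu> c" if "c \<notin> T" "\<And>i j. c \<noteq> Entry k i j"
    using * that by auto
qed

lemma arithmetic_cost_le_for_entries:
  fixes body :: "'m::finite \<Rightarrow> 'n::finite \<Rightarrow> ('m, 'n) prog"
  assumes "\<And>i j. arithmetic_cost_le s S (body i j) K"
  shows "arithmetic_cost_le s S (for_entries body) (CARD('m) * CARD('n) * K)"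
  using arithmetic_cost_le_block_map[of "List.product indices indices" s S "\<lambda>(i, j). body i j" K] assms
  by (auto simp: for_entries_def length_indices)

section \<open>Programs for the parts of an iteration\<close>

definition dot_loop :: "nat \<Rightarrow> 'm \<Rightarrow> 'n \<Rightarrow> ('m, 'n) prog" where
  "dot_loop n i j = block (map (\<lambda>l. block
     [Do (Calc (Scalar 4) Times (Sval l) (Left l i)),
      Do (Calc (Scalar 4) Times (Scalar 4) (Right l j)),
      Do (Calc (Scalar 3) Plus (Scalar 3) (Scalar 4))]) [0..<n])"

definition combine :: "nat \<Rightarrow> nat \<Rightarrow> ('m::finite, 'n::finite) prog" where
  "combine s k = for_entries (\<lambda>i j. block
     [Do (Const (Scalar 3) 0), dot_loop s i j, Do (Copy (Entry k i j) (Scalar 3))])"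

definition svd_sum :: "nat \<Rightarrow> ('m::finite, 'n::finite) memory \<Rightarrow> real^'n^'m" where
  "svd_sum s \<mu> = (\<Sum>l<s. \<mu> (Sval l) *\<^sub>R outer_prod (\<chi> i. \<mu> (Left l i)) (\<chi> j. \<mu> (Right l j)))"

lemma exec_dot_loop:
  "exec s S (dot_loop n i j) \<mu> (Scalar 3) =
    \<mu> (Scalar 3) + (\<Sum>l<n. \<mu> (Sval l) * \<mu> (Left l i) * \<mu> (Right l j))"
  "c \<noteq> Scalar 3 \<Longrightarrow> c \<noteq> Scalar 4 \<Longrightarrow> exec s S (dot_loop n i j) \<mu> c = \<mu> c"
proof -
  have "exec s S (dot_loop n i j) \<mu> (Scalar 3) =
      \<mu> (Scalar 3) + (\<Sum>l<n. \<mu> (Sval l) * \<mu> (Left l i) * \<mu> (Right l j)) \<and>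
    (\<forall>c. c \<noteq> Scalar 3 \<longrightarrow> c \<noteq> Scalar 4 \<longrightarrow> exec s S (dot_loop n i j) \<mu> c = \<mu> c)"
    unfolding dot_loop_def by (induction n) auto
  then show "exec s S (dot_loop n i j) \<mu> (Scalar 3) =
      \<mu> (Scalar 3) + (\<Sum>l<n. \<mu> (Sval l) * \<mu> (Left l i) * \<mu> (Right l j))"
    "c \<noteq> Scalar 3 \<Longrightarrow> c \<noteq> Scalar 4 \<Longrightarrow> exec s S (dot_loop n i j) \<mu> c = \<mu> c" by auto
qed

lemma exec_combine:
  fixes \<mu> :: "('m::finite, 'n::finite) memory"
  shows "matrix_at (exec s S (combine n k) \<mu>) k = svd_sum n \<mu>"
    and "c \<notin> {Scalar 3, Scalar 4} \<Longrightarrow> (\<And>i j. c \<noteq> Entry k i j) \<Longrightarrow> exec s S (combine n k) \<mu> c = \<mu> c"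
proof -
  let ?F = "\<lambda>i j \<mu>. \<Sum>l<n. \<mu> (Sval l) * \<mu> (Left l i) * \<mu> (Right l j)"
  let ?body = "\<lambda>i j. block [Do (Const (Scalar 3) 0), dot_loop n i j, Do (Copy (Entry k i j) (Scalar 3))]"
  have *: "exec s S (?body i j) \<mu> (Entry k i j) = ?F i j \<mu>"
    "c \<noteq> Entry k i j \<Longrightarrow> c \<notin> {Scalar 3, Scalar 4} \<Longrightarrow> exec s S (?body i j) \<mu> c = \<mu> c"
    for i j c and \<mu> :: "('m, 'n) memory"
    by (simp_all add: exec_dot_loop)
  have "?F i j \<mu> = ?F i j \<nu>" if "\<forall>c. c \<notin> {Scalar 3, Scalar 4} \<and>
      (\<forall>i' j'. c = Entry k i' j' \<longrightarrow> i' = i \<and> j' = j) \<longrightarrow> \<mu> c = \<nu> c"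
    for i j and \<mu> \<nu> :: "('m, 'n) memory"
    by (simp add: that)
  note E = exec_for_entries[where F = ?F and body = ?body and T = "{Scalar 3, Scalar 4}" and k = k, OF * this]
  show "matrix_at (exec s S (combine n k) \<mu>) k = svd_sum n \<mu>"
    unfolding combine_def by (subst E) (simp_all add: svd_sum_def vec_eq_iff outer_prod_def mult.assoc)
  show "c \<notin> {Scalar 3, Scalar 4} \<Longrightarrow> (\<And>i j. c \<noteq> Entry k i j) \<Longrightarrow> exec s S (combine n k) \<mu> c = \<mu> c"
    unfolding combine_def by (rule E(2)) auto
qed

lemma cost_combine:
  "arithmetic_cost_le s S (combine n k :: ('m::finite, 'n::finite) prog) (CARD('m) * CARD('n) * (3 * n + 2))"
proof -
  \<comment> \<open>The nested sums reproduce the shape in which the composition rules build the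
    bound; monotonicity simplifies it at the end.\<close>
  have "arithmetic_cost_le s S (dot_loop n i j :: ('m, 'n) prog) (length [0..<n] * (1 + (1 + (1 + 0))))" for i j
    unfolding dot_loop_def by (intro arithmetic_cost_intros) auto
  then have "arithmetic_cost_le s S (block
     [Do (Const (Scalar 3) 0), dot_loop n i j, Do (Copy (Entry k i j) (Scalar 3))] :: ('m, 'n) prog)
     (1 + (length [0..<n] * (1 + (1 + (1 + 0))) + (1 + 0)))" for i j
    by (intro arithmetic_cost_intros) auto
  from arithmetic_cost_le_for_entries[OF this] show ?thesis
    unfolding combine_def by (rule arithmetic_cost_le_mono) simp
qed

text \<open>The factor is \<open>1 / (4 s \<beta> \<eta>) = 16 / \<alpha>\<close>.\<close>

definition gradient_point :: "('m::finite, 'n::finite) prog" where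
  "gradient_point = block
     [Do (Const (Scalar 3) 16), Do (Calc (Scalar 3) Divide (Scalar 3) (Scalar 2)),
      for_entries (\<lambda>i j. block
        [Do (Calc (Scalar 4) Times (Scalar 3) (Entry 2 i j)),
         Do (Calc (Entry 3 i j) Minus (Entry 1 i j) (Scalar 4))])]"

lemma exec_gradient_point:
  fixes \<mu> :: "('m::finite, 'n::finite) memory"
  shows "matrix_at (exec s S gradient_point \<mu>) 3 = matrix_at \<mu> 1 - (16 / \<mu> (Scalar 2)) *\<^sub>R matrix_at \<mu> 2"
    and "c \<notin> {Scalar 3, Scalar 4} \<Longrightarrow> (\<And>i j. c \<noteq> Entry 3 i j) \<Longrightarrow> exec s S gradient_point \<mu> c = \<mu> c"
proof -
  let ?F = "\<lambda>i j \<mu>. \<mu> (Entry 1 i j) - \<mu> (Scalar 3) * \<mu> (Entry 2 i j)"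
  let ?body = "\<lambda>i j. block [Do (Calc (Scalar 4) Times (Scalar 3) (Entry 2 i j)),
         Do (Calc (Entry 3 i j) Minus (Entry 1 i j) (Scalar 4))]"
  have *: "exec s S (?body i j) \<mu> (Entry 3 i j) = ?F i j \<mu>"
    "c \<noteq> Entry 3 i j \<Longrightarrow> c \<notin> {Scalar 4} \<Longrightarrow> exec s S (?body i j) \<mu> c = \<mu> c"
    for i j c and \<mu> :: "('m, 'n) memory"
    by simp_all
  have "?F i j \<mu> = ?F i j \<nu>" if "\<forall>c. c \<notin> {Scalar 4} \<and>
      (\<forall>i' j'. c = Entry 3 i' j' \<longrightarrow> i' = i \<and> j' = j) \<longrightarrow> \<mu> c = \<nu> c"
    for i j and \<mu> \<nu> :: "('m, 'n) memory"
    by (simp add: that)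
  note E = exec_for_entries[where F = ?F and body = ?body and T = "{Scalar 4}" and k = 3, OF * this]
  show "matrix_at (exec s S gradient_point \<mu>) 3 = matrix_at \<mu> 1 - (16 / \<mu> (Scalar 2)) *\<^sub>R matrix_at \<mu> 2"
    unfolding gradient_point_def exec_block exec.simps exec_instr.simps
    by (subst E) (simp_all add: vec_eq_iff matrix_at_def)
  show "exec s S gradient_point \<mu> c = \<mu> c" if "c \<notin> {Scalar 3, Scalar 4}" "\<And>i j. c \<noteq> Entry 3 i j"
    unfolding gradient_point_def exec_block exec.simps exec_instr.simps
    by (subst E) (use that in auto)
qed

lemma cost_gradient_point:
  "arithmetic_cost_le s S (gradient_point :: ('m::finite, 'n::finite) prog) (CARD('m) * CARD('n) * 2 + 2)"
proof -
  have "arithmetic_cost_le s S (gradient_point :: ('m::finite, 'n::finite) prog)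
      (1 + (1 + (CARD('m) * CARD('n) * (1 + (1 + 0)) + 0)))"
    unfolding gradient_point_def by (intro arithmetic_cost_intros arithmetic_cost_le_for_entries) auto
  then show ?thesis by (rule arithmetic_cost_le_mono) simp
qed

text \<open>\<open>Scalar 6\<close> enters with \<open>- R\<close>, so it always holds the numerator
  of the current candidate, and \<open>Scalar 5\<close> holds the running maximum. The denominators
  are literals of the unrolled loop.\<close>

definition threshold_loop :: "nat \<Rightarrow> ('m, 'n) prog" where
  "threshold_loop n = block (map (\<lambda>l. block
     [Do (Calc (Scalar 6) Plus (Scalar 6) (Sval l)),
      Do (Const (Scalar 4) (real (Suc l))),
      Do (Calc (Scalar 4) Divide (Scalar 6) (Scalar 4)),
      If_le (Scalar 5) (Scalar 4) (Do (Copy (Scalar 5) (Scalar 4))) (block [])]) [0..<n])"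

definition shrink_loop :: "nat \<Rightarrow> ('m, 'n) prog" where
  "shrink_loop n = block (map (\<lambda>l. block
     [Do (Calc (Scalar 4) Minus (Sval l) (Scalar 5)),
      Do (Const (Scalar 6) 0),
      If_le (Scalar 6) (Scalar 4) (Do (Copy (Sval l) (Scalar 4))) (Do (Copy (Sval l) (Scalar 6)))]) [0..<n])"

definition project_simplex :: "nat \<Rightarrow> ('m, 'n) prog" where
  "project_simplex n = block
     [Do (Const (Scalar 5) 0), Do (Const (Scalar 6) 0), Do (Calc (Scalar 6) Minus (Scalar 6) (Scalar 0)),
      threshold_loop n, shrink_loop n]"

lemma exec_threshold_loop:
  assumes "\<mu> (Scalar 5) = 0" "\<mu> (Scalar 6) = - R"
  shows "exec s S (threshold_loop n) \<mu> (Scalar 5) = threshold R (\<lambda>l. \<mu> (Sval l)) n \<and>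
    exec s S (threshold_loop n) \<mu> (Scalar 6) = (\<Sum>l<n. \<mu> (Sval l)) - R \<and>
    (\<forall>c. c \<notin> {Scalar 4, Scalar 5, Scalar 6} \<longrightarrow> exec s S (threshold_loop n) \<mu> c = \<mu> c)"
  unfolding threshold_loop_def by (induction n) (auto simp: assms max_def diff_add_eq)

lemma exec_shrink_loop:
  "(\<forall>l<n. exec s S (shrink_loop n) \<mu> (Sval l) = max (\<mu> (Sval l) - \<mu> (Scalar 5)) 0) \<and>
    (\<forall>c. c \<notin> {Scalar 4, Scalar 6} \<union> Sval ` {..<n} \<longrightarrow> exec s S (shrink_loop n) \<mu> c = \<mu> c)"
  unfolding shrink_loop_def by (induction n) (auto simp: less_Suc_eq max_def image_iff)

lemma exec_project_simplex:
  fixes \<mu> :: "('m::finite, 'n::finite) memory"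
  shows "l < n \<Longrightarrow> exec s S (project_simplex n) \<mu> (Sval l) =
      max (\<mu> (Sval l) - threshold (\<mu> (Scalar 0)) (\<lambda>l. \<mu> (Sval l)) n) 0"
    and "c \<notin> {Scalar 4, Scalar 5, Scalar 6} \<union> Sval ` {..<n} \<Longrightarrow> exec s S (project_simplex n) \<mu> c = \<mu> c"
proof -
  let ?\<mu> = "\<mu>(Scalar 5 := 0, Scalar 6 := - \<mu> (Scalar 0))"
  let ?\<nu> = "exec s S (threshold_loop n) ?\<mu>"
  have e: "exec s S (project_simplex n) \<mu> = exec s S (shrink_loop n) ?\<nu>"
    by (simp add: project_simplex_def)
  have 1: "?\<nu> (Scalar 5) = threshold (\<mu> (Scalar 0)) (\<lambda>l. \<mu> (Sval l)) n"
    "c \<notin> {Scalar 4, Scalar 5, Scalar 6} \<Longrightarrow> ?\<nu> c = \<mu> c" for c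
    using exec_threshold_loop[of ?\<mu> "\<mu> (Scalar 0)" s S n] by auto
  show "l < n \<Longrightarrow> exec s S (project_simplex n) \<mu> (Sval l) =
      max (\<mu> (Sval l) - threshold (\<mu> (Scalar 0)) (\<lambda>l. \<mu> (Sval l)) n) 0"
    unfolding e using exec_shrink_loop[of n s S ?\<nu>] by (simp add: 1)
  show "c \<notin> {Scalar 4, Scalar 5, Scalar 6} \<union> Sval ` {..<n} \<Longrightarrow> exec s S (project_simplex n) \<mu> c = \<mu> c"
    unfolding e using exec_shrink_loop[of n s S ?\<nu>] 1(2)[of c] by auto
qed

lemma cost_project_simplex:
  "arithmetic_cost_le s S (project_simplex n :: ('m::finite, 'n::finite) prog) (9 * n + 3)"
proof -
  have "arithmetic_cost_le s S (Do (Copy a b) :: ('m, 'n) prog) 1" for a b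
    by (intro arithmetic_cost_intros) simp
  \<comment> \<open>The rule for conditionals uses one bound for both branches, so the empty branch
    is charged 1 as well.\<close>
  have skip: "arithmetic_cost_le s S (block [] :: ('m, 'n) prog) 1"
    by (simp add: arithmetic_cost_le_def block_def)
  have "arithmetic_cost_le s S (threshold_loop n :: ('m, 'n) prog)
      (length [0..<n] * (1 + (1 + (1 + (Suc 1 + 0)))))"
    unfolding threshold_loop_def by (intro arithmetic_cost_intros skip) auto
  moreover have "arithmetic_cost_le s S (shrink_loop n :: ('m, 'n) prog)
      (length [0..<n] * (1 + (1 + (Suc 1 + 0))))"
    unfolding shrink_loop_def by (intro arithmetic_cost_intros) auto
  ultimately have "arithmetic_cost_le s S (project_simplex n :: ('m, 'n) prog)
      (1 + (1 + (1 + (length [0..<n] * (1 + (1 + (1 + (Suc 1 + 0)))) +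
        (length [0..<n] * (1 + (1 + (Suc 1 + 0))) + 0)))))"
    unfolding project_simplex_def by (intro arithmetic_cost_intros) auto
  then show ?thesis by (rule arithmetic_cost_le_mono) simp
qed

text \<open>The program may depend on \<open>s\<close> but not on the problem data, so
  \<open>1 / (64 * s)\<close> is a literal, while the growth and Lipschitz constants are read from
  memory.\<close>

definition step_size :: "nat \<Rightarrow> step_rule \<Rightarrow> ('m, 'n) prog" where
  "step_size s rule = (case rule of
     Line_Search \<Rightarrow> Do (Line 5 0 4)
   | Predefined \<Rightarrow> block
      [Do (Const (Scalar 5) (1 / (64 * real s))), Do (Calc (Scalar 5) Times (Scalar 5) (Scalar 2)),
       Do (Calc (Scalar 5) Divide (Scalar 5) (Scalar 1))])"

lemma exec_step_size:
  "c \<noteq> Scalar 5 \<Longrightarrow> exec s S (step_size n rule) \<mu> c = \<mu> c"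
  "exec s S (step_size n rule) \<mu> (Scalar 5) = (case rule of
     Line_Search \<Rightarrow> line_sub S (matrix_at \<mu> 0) (matrix_at \<mu> 4)
   | Predefined \<Rightarrow> step_param n (\<mu> (Scalar 1)) (\<mu> (Scalar 2)))"
  by (simp_all add: step_size_def step_param_def split: step_rule.split)

lemma cost_step_size:
  "cost s S (step_size n rule) \<mu> r \<le>
    (case r of Elementary \<Rightarrow> 3 | Line_Call \<Rightarrow> (case rule of Line_Search \<Rightarrow> 1 | Predefined \<Rightarrow> 0) | _ \<Rightarrow> 0)"
  by (cases r) (simp_all add: step_size_def block_def split: step_rule.split)

definition update :: "('m::finite, 'n::finite) prog" where
  "update = block
     [Do (Const (Scalar 3) 1), Do (Calc (Scalar 3) Minus (Scalar 3) (Scalar 5)),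
      for_entries (\<lambda>i j. block
        [Do (Calc (Scalar 4) Times (Scalar 3) (Entry 0 i j)),
         Do (Calc (Scalar 6) Times (Scalar 5) (Entry 4 i j)),
         Do (Calc (Entry 0 i j) Plus (Scalar 4) (Scalar 6))])]"

lemma exec_update:
  fixes \<mu> :: "('m::finite, 'n::finite) memory"
  shows "matrix_at (exec s S update \<mu>) 0 =
      (1 - \<mu> (Scalar 5)) *\<^sub>R matrix_at \<mu> 0 + \<mu> (Scalar 5) *\<^sub>R matrix_at \<mu> 4"
    and "c \<notin> {Scalar 3, Scalar 4, Scalar 6} \<Longrightarrow> (\<And>i j. c \<noteq> Entry 0 i j) \<Longrightarrow> exec s S update \<mu> c = \<mu> c"
proof -
  let ?F = "\<lambda>i j \<mu>. \<mu> (Scalar 3) * \<mu> (Entry 0 i j) + \<mu> (Scalar 5) * \<mu> (Entry 4 i j)"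
  let ?body = "\<lambda>i j. block [Do (Calc (Scalar 4) Times (Scalar 3) (Entry 0 i j)),
         Do (Calc (Scalar 6) Times (Scalar 5) (Entry 4 i j)),
         Do (Calc (Entry 0 i j) Plus (Scalar 4) (Scalar 6))]"
  have *: "exec s S (?body i j) \<mu> (Entry 0 i j) = ?F i j \<mu>"
    "c \<noteq> Entry 0 i j \<Longrightarrow> c \<notin> {Scalar 4, Scalar 6} \<Longrightarrow> exec s S (?body i j) \<mu> c = \<mu> c"
    for i j c and \<mu> :: "('m, 'n) memory"
    by simp_all
  have "?F i j \<mu> = ?F i j \<nu>" if "\<forall>c. c \<notin> {Scalar 4, Scalar 6} \<and>
      (\<forall>i' j'. c = Entry 0 i' j' \<longrightarrow> i' = i \<and> j' = j) \<longrightarrow> \<mu> c = \<nu> c"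
    for i j and \<mu> \<nu> :: "('m, 'n) memory"
    by (simp add: that)
  note E = exec_for_entries[where F = ?F and body = ?body and T = "{Scalar 4, Scalar 6}" and k = 0, OF * this]
  show "matrix_at (exec s S update \<mu>) 0 =
      (1 - \<mu> (Scalar 5)) *\<^sub>R matrix_at \<mu> 0 + \<mu> (Scalar 5) *\<^sub>R matrix_at \<mu> 4"
    unfolding update_def exec_block exec.simps exec_instr.simps
    by (subst E) (simp_all add: vec_eq_iff matrix_at_def)
  show "exec s S update \<mu> c = \<mu> c" if "c \<notin> {Scalar 3, Scalar 4, Scalar 6}" "\<And>i j. c \<noteq> Entry 0 i j"
    unfolding update_def exec_block exec.simps exec_instr.simps
    by (subst E) (use that in auto)
qed

lemma cost_update:
  "arithmetic_cost_le s S (update :: ('m::finite, 'n::finite) prog) (CARD('m) * CARD('n) * 3 + 2)"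
proof -
  have "arithmetic_cost_le s S (update :: ('m, 'n) prog)
      (1 + (1 + (CARD('m) * CARD('n) * (1 + (1 + (1 + 0))) + 0)))"
    unfolding update_def by (intro arithmetic_cost_intros arithmetic_cost_le_for_entries) auto
  then show ?thesis by (rule arithmetic_cost_le_mono) simp
qed

section \<open>The complete iteration: cost and correctness\<close>

definition iteration :: "nat \<Rightarrow> step_rule \<Rightarrow> ('m::finite, 'n::finite) prog" where
  "iteration s rule = block
     [Do (Svd 0), combine s 1, Do (Grad 2 0), gradient_point, Do (Svd 3), project_simplex s,
      combine s 4, step_size s rule, update]"

lemma iteration_dominated:
  fixes S :: "('m::finite, 'n::finite) subroutines"
  assumes "0 < s"
  shows "dominated_by_two_svds s S rule (iteration s rule) \<mu>"
proof -
  let ?N = "CARD('m) * CARD('n)"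
  note C = arithmetic_cost_leD[OF cost_combine] arithmetic_cost_leD[OF cost_gradient_point]
    arithmetic_cost_leD[OF cost_project_simplex] arithmetic_cost_leD[OF cost_update]
  have other: "cost s S (iteration s rule) \<mu> r \<le>
      (case r of Svd_Call \<Rightarrow> 2 | Grad_Call \<Rightarrow> 1 |
         Line_Call \<Rightarrow> (case rule of Line_Search \<Rightarrow> 1 | Predefined \<Rightarrow> 0))" if "r \<noteq> Elementary" for r
    using cost_step_size[of s S s rule _ r] that
    by (cases r) (simp_all add: iteration_def block_def C)
  have "cost s S (iteration s rule) \<mu> Elementary \<le> ?N * (3 * s + 2) + (?N * 2 + 2 + (9 * s + 3 + (?N * (3 * s + 2) + (3 + (?N * 3 + 2)))))"
    unfolding iteration_def block_def
    using cost_step_size[of s S s rule _ Elementary]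
    by (simp only: foldr.simps o_apply id_apply cost.simps resource_of.simps resource.simps if_False add_0 add_0_right)
       (intro add_mono C; simp)
  also have "\<dots> = 6 * (s * ?N) + 9 * ?N + 9 * s + 10" by (simp add: algebra_simps)
  also have "\<dots> \<le> 100 * (s * ?N)"
  proof -
    \<comment> \<open>Positivity of \<open>s\<close> and of the dimensions absorbs the lower-order
      terms, for a total factor of 34.\<close>
    have "?N \<le> s * ?N" "s \<le> s * ?N" "1 \<le> s * ?N" using assms by (simp_all add: Suc_leI)
    then show ?thesis by linarith
  qed
  finally show ?thesis
    using other[of Svd_Call] other[of Grad_Call] other[of Line_Call]
    by (simp add: dominated_by_two_svds_def mult.assoc)
qed

text \<open>Up to a term independent of \<open>W\<close>, the linearised objective is a multiple of
  a squared distance, so the subproblem is a Euclidean projection.\<close>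

lemma complete_the_square:
  fixes W :: "'a::real_inner"
  assumes "2 * c * a = 1"
  shows "(W - X) \<bullet> G + c * (norm (W - Z))\<^sup>2 =
    c * (norm (W - (Z - a *\<^sub>R G)))\<^sup>2 + ((Z - X) \<bullet> G - a / 2 * (norm G)\<^sup>2)"
proof -
  define D where "D = W - Z"
  have e: "W - (Z - a *\<^sub>R G) = D + a *\<^sub>R G" by (simp add: D_def)
  have "(norm (W - (Z - a *\<^sub>R G)))\<^sup>2 = (norm D)\<^sup>2 + 2 * a * (D \<bullet> G) + a\<^sup>2 * (norm G)\<^sup>2"
    unfolding e power2_norm_eq_inner
    by (simp add: inner_add_left inner_add_right inner_commute[of G D] power2_eq_square distrib_left)
  then have "c * (norm (W - (Z - a *\<^sub>R G)))\<^sup>2 =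
      c * (norm D)\<^sup>2 + (2 * c * a) * (D \<bullet> G) + (2 * c * a) * (a / 2 * (norm G)\<^sup>2)"
    by (simp add: power2_eq_square algebra_simps)
  then show ?thesis by (simp add: assms D_def inner_diff_left)
qed

lemma is_arg_min_affine:
  fixes h h' :: "'a \<Rightarrow> real"
  assumes "is_arg_min h P x" "0 \<le> c" "\<And>y. h' y = c * h y + d"
  shows "is_arg_min h' P x"
  using assms by (auto simp: is_arg_min_linorder mult_left_mono)

text \<open>The computed part is extended to a full decomposition, since the optimality of both
  projections refers to one.\<close>

lemma exec_Svd:
  fixes \<mu> :: "('m::finite, 'n::finite) memory"
  assumes "correct_subroutines f g s S"
  obtains \<sigma> u v where "is_svd (matrix_at \<mu> k) \<sigma> u v"
    and "\<And>l. l < s \<Longrightarrow> exec s S (Do (Svd k)) \<mu> (Sval l) = \<sigma> l"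
    and "\<And>l i. l < s \<Longrightarrow> exec s S (Do (Svd k)) \<mu> (Left l i) = u l $ i"
    and "\<And>l j. l < s \<Longrightarrow> exec s S (Do (Svd k)) \<mu> (Right l j) = v l $ j"
    and "\<And>k' i j. exec s S (Do (Svd k)) \<mu> (Entry k' i j) = \<mu> (Entry k' i j)"
    and "\<And>l. exec s S (Do (Svd k)) \<mu> (Scalar l) = \<mu> (Scalar l)"
proof -
  obtain \<sigma> u v where e: "svd_sub S (matrix_at \<mu> k) = (\<sigma>, u, v)" by (cases "svd_sub S (matrix_at \<mu> k)")
  have "is_leading_svd s (matrix_at \<mu> k) (\<sigma>, u, v)"
    using assms unfolding correct_subroutines_def e[symmetric] by blast
  then obtain \<sigma>' u' v' where "is_svd (matrix_at \<mu> k) \<sigma>' u' v'"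
    "\<forall>l<s. \<sigma> l = \<sigma>' l \<and> u l = u' l \<and> v l = v' l"
    unfolding is_leading_svd_def by auto
  then show ?thesis by (intro that[of \<sigma>' u' v']) (simp_all add: e store_svd_def)
qed

lemma svd_sum_eq:
  assumes "\<And>l. l < s \<Longrightarrow> \<mu> (Sval l) = c l" "\<And>l i. l < s \<Longrightarrow> \<mu> (Left l i) = u l $ i"
    "\<And>l j. l < s \<Longrightarrow> \<mu> (Right l j) = v l $ j"
  shows "svd_sum s \<mu> = (\<Sum>l<s. c l *\<^sub>R outer_prod (u l) (v l))"
  unfolding svd_sum_def by (intro sum.cong) (auto simp: assms)

lemma matrix_at_cong:
  "(\<And>i j. \<mu> (Entry k i j) = \<nu> (Entry k i j)) \<Longrightarrow> matrix_at \<mu> k = matrix_at \<nu> k"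
  by (simp add: matrix_at_def)

lemma exec_iteration:
  fixes \<mu> :: "('m::finite, 'n::finite) memory" and f :: "real^'n^'m \<Rightarrow> real"
  assumes S: "correct_subroutines f g s S" and s: "0 < s" "s \<le> num_sv TYPE(real^'n^'m)"
    and R: "\<mu> (Scalar 0) = R" "0 < R" and \<beta>: "\<mu> (Scalar 1) = \<beta>" "0 < \<beta>"
    and \<alpha>: "\<mu> (Scalar 2) = \<alpha>" "0 < \<alpha>"
  shows "fw_step f g R s \<beta> (step_param s \<beta> \<alpha>) rule (matrix_at \<mu> 0)
      (matrix_at (exec s S (iteration s rule) \<mu>) 0)"
    and "l < 3 \<Longrightarrow> exec s S (iteration s rule) \<mu> (Scalar l) = \<mu> (Scalar l)"
proof -
  define \<mu>1 where "\<mu>1 = exec s S (Do (Svd 0)) \<mu>"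
  define \<mu>2 where "\<mu>2 = exec s S (combine s 1) \<mu>1"
  define \<mu>3 where "\<mu>3 = exec s S (Do (Grad 2 0)) \<mu>2"
  define \<mu>4 where "\<mu>4 = exec s S gradient_point \<mu>3"
  define \<mu>5 where "\<mu>5 = exec s S (Do (Svd 3)) \<mu>4"
  define \<mu>6 where "\<mu>6 = exec s S (project_simplex s) \<mu>5"
  define \<mu>7 where "\<mu>7 = exec s S (combine s 4) \<mu>6"
  define \<mu>8 where "\<mu>8 = exec s S (step_size s rule) \<mu>7"
  define \<mu>9 where "\<mu>9 = exec s S update \<mu>8"
  have iter: "exec s S (iteration s rule) \<mu> = \<mu>9"
    by (simp only: iteration_def exec_block \<mu>1_def \<mu>2_def \<mu>3_def \<mu>4_def \<mu>5_def \<mu>6_def \<mu>7_def \<mu>8_def \<mu>9_def)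
  define X where "X = matrix_at \<mu> 0"

  obtain \<sigma> u v where svd1: "is_svd X \<sigma> u v"
    and L1: "\<And>l. l < s \<Longrightarrow> \<mu>1 (Sval l) = \<sigma> l" "\<And>l i. l < s \<Longrightarrow> \<mu>1 (Left l i) = u l $ i"
      "\<And>l j. l < s \<Longrightarrow> \<mu>1 (Right l j) = v l $ j"
    and E1: "\<And>k i j. \<mu>1 (Entry k i j) = \<mu> (Entry k i j)" and S1: "\<And>l. \<mu>1 (Scalar l) = \<mu> (Scalar l)"
    by (rule exec_Svd[OF S, of \<mu> 0, folded \<mu>1_def X_def]) (rule that; assumption)
  define Z where "Z = (\<Sum>l<s. \<sigma> l *\<^sub>R outer_prod (u l) (v l))"
  have Z: "is_arg_min (\<lambda>Z. dist X Z) (\<lambda>Z. rank Z \<le> s) Z"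
    unfolding Z_def by (rule eckart_young[OF svd1 s(2)])

  have M2: "matrix_at \<mu>2 1 = Z" "matrix_at \<mu>2 0 = X"
    unfolding \<mu>2_def Z_def X_def using exec_combine(1)[of s S s 1 \<mu>1] svd_sum_eq[of s \<mu>1, OF L1]
    by (auto intro!: matrix_at_cong simp: exec_combine(2) E1)
  have S2: "\<mu>2 (Scalar l) = \<mu> (Scalar l)" if "l < 3" for l
    using that unfolding \<mu>2_def by (subst exec_combine(2)) (auto simp: S1)

  have M3: "matrix_at \<mu>3 1 = Z" "matrix_at \<mu>3 0 = X" "matrix_at \<mu>3 2 = g X"
  proof -
    have "matrix_at \<mu>3 k = matrix_at \<mu>2 k" if "k \<noteq> 2" for k
      using that by (intro matrix_at_cong) (simp add: \<mu>3_def store_matrix_def)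
    from this[of 1] this[of 0] show "matrix_at \<mu>3 1 = Z" "matrix_at \<mu>3 0 = X" using M2 by simp_all
    show "matrix_at \<mu>3 2 = g X"
      using S by (simp add: \<mu>3_def matrix_at_def[of _ 2] store_matrix_def M2 correct_subroutines_def vec_eq_iff)
  qed
  have S3: "\<mu>3 (Scalar l) = \<mu> (Scalar l)" if "l < 3" for l
    using S2[OF that] by (simp add: \<mu>3_def store_matrix_def)

  define Y where "Y = Z - (16 / \<alpha>) *\<^sub>R g X"
  have M4: "matrix_at \<mu>4 3 = Y" "matrix_at \<mu>4 0 = X"
  proof -
    show "matrix_at \<mu>4 3 = Y"
      unfolding \<mu>4_def by (subst exec_gradient_point) (simp add: M3[simplified] S3 \<alpha> Y_def)
    have "matrix_at \<mu>4 0 = matrix_at \<mu>3 0"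
      unfolding \<mu>4_def by (rule matrix_at_cong, rule exec_gradient_point) auto
    then show "matrix_at \<mu>4 0 = X" by (simp add: M3)
  qed
  have S4: "\<mu>4 (Scalar l) = \<mu> (Scalar l)" if "l < 3" for l
    using that S3[OF that] unfolding \<mu>4_def by (subst exec_gradient_point(2)) auto

  obtain \<rho> a b where svd5: "is_svd Y \<rho> a b"
    and L5: "\<And>l. l < s \<Longrightarrow> \<mu>5 (Sval l) = \<rho> l" "\<And>l i. l < s \<Longrightarrow> \<mu>5 (Left l i) = a l $ i"
      "\<And>l j. l < s \<Longrightarrow> \<mu>5 (Right l j) = b l $ j"
    and E5: "\<And>k i j. \<mu>5 (Entry k i j) = \<mu>4 (Entry k i j)" and S5: "\<And>l. \<mu>5 (Scalar l) = \<mu>4 (Scalar l)"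
    by (rule exec_Svd[OF S, of \<mu>4 3, folded \<mu>5_def M4(1)[symmetric], unfolded M4(1)]) (rule that; assumption)

  define \<tau> where "\<tau> = threshold R (\<lambda>l. \<mu>5 (Sval l)) s"
  define V where "V = (\<Sum>l<s. max (\<rho> l - \<tau>) 0 *\<^sub>R outer_prod (a l) (b l))"
  have L6: "\<mu>6 (Sval l) = max (\<rho> l - \<tau>) 0" "\<mu>6 (Left l i) = a l $ i" "\<mu>6 (Right l j) = b l $ j"
    if "l < s" for l i j
    using that unfolding \<mu>6_def
    by (simp_all add: exec_project_simplex image_iff L5 S5 S4 R \<tau>_def)
  have E6: "\<mu>6 (Entry k i j) = \<mu>4 (Entry k i j)" for k i j
    unfolding \<mu>6_def by (subst exec_project_simplex(2)) (auto simp: E5)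
  have S6: "\<mu>6 (Scalar l) = \<mu> (Scalar l)" if "l < 3" for l
    using that unfolding \<mu>6_def by (subst exec_project_simplex(2)) (auto simp: S5 S4)

  have dec: "\<mu>5 (Sval l) \<le> \<mu>5 (Sval k)" if "k \<le> l" "l < s" for k l
    using that svd5 s(2) by (simp add: L5 is_svd_iff)
  have sum: "(\<Sum>l<s. max (\<rho> l - \<tau>) 0) = (\<Sum>l<s. max (\<mu>5 (Sval l) - \<tau>) 0)"
    by (simp add: L5)
  have "is_arg_min (\<lambda>W. (norm (W - Y))\<^sup>2) (\<lambda>W. W \<in> nuclear_ball R \<and> rank W \<le> s) V"
    unfolding V_def
  proof (rule low_rank_ball_projection[OF svd5 s(2)])
    show "0 \<le> \<tau>" by (simp add: \<tau>_def threshold_nonneg)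
    show "(\<Sum>l<s. max (\<rho> l - \<tau>) 0) \<le> R"
      unfolding sum unfolding \<tau>_def by (rule threshold_sum_le[OF R(2) dec])
    show "0 < \<tau> \<Longrightarrow> (\<Sum>l<s. max (\<rho> l - \<tau>) 0) = R"
      unfolding sum unfolding \<tau>_def by (rule threshold_sum_eq[OF R(2) dec])
  qed
  then have V: "is_arg_min (\<lambda>W. (W - X) \<bullet> g X + 2 * real s * \<beta> * step_param s \<beta> \<alpha> * (norm (W - Z))\<^sup>2)
      (\<lambda>W. W \<in> nuclear_ball R \<and> rank W \<le> s) V"
  proof (rule is_arg_min_affine)
    show "0 \<le> 2 * real s * \<beta> * step_param s \<beta> \<alpha>" using \<alpha> \<beta> by (simp add: step_param_def)
    \<comment> \<open>Here \<open>c = 2 * s * \<beta> * \<eta> = \<alpha> / 32\<close>, so the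
      matching step is \<open>1 / (2 * c) = 16 / \<alpha>\<close>, the factor of
      \<open>gradient_point\<close>.\<close>
    show "(W - X) \<bullet> g X + 2 * real s * \<beta> * step_param s \<beta> \<alpha> * (norm (W - Z))\<^sup>2 =
        2 * real s * \<beta> * step_param s \<beta> \<alpha> * (norm (W - Y))\<^sup>2 + ((Z - X) \<bullet> g X - 16 / \<alpha> / 2 * (norm (g X))\<^sup>2)" for W
      unfolding Y_def by (rule complete_the_square) (use \<alpha> \<beta> s in \<open>simp add: step_param_def\<close>)
  qed

  have M7: "matrix_at \<mu>7 4 = V" "matrix_at \<mu>7 0 = X"
  proof -
    show "matrix_at \<mu>7 4 = V"
      unfolding \<mu>7_def V_def exec_combine by (rule svd_sum_eq[OF L6])
    have "matrix_at \<mu>7 0 = matrix_at \<mu>4 0"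
      unfolding \<mu>7_def by (rule matrix_at_cong, subst exec_combine(2)) (auto simp: E6)
    then show "matrix_at \<mu>7 0 = X" by (simp add: M4)
  qed
  have S7: "\<mu>7 (Scalar l) = \<mu> (Scalar l)" if "l < 3" for l
    using that unfolding \<mu>7_def by (subst exec_combine(2)) (auto simp: S6)

  define \<gamma> where "\<gamma> = \<mu>8 (Scalar 5)"
  have M8: "matrix_at \<mu>8 4 = V" "matrix_at \<mu>8 0 = X"
    using M7 by (simp_all add: \<mu>8_def matrix_at_def exec_step_size)
  have \<gamma>: "\<gamma> = (case rule of Line_Search \<Rightarrow> line_sub S X V | Predefined \<Rightarrow> step_param s \<beta> \<alpha>)"
  proof -
    have "\<mu>7 (Scalar 1) = \<beta>" "\<mu>7 (Scalar 2) = \<alpha>" using S7[of 1] S7[of 2] \<alpha> \<beta> by simp_all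
    then show ?thesis by (simp only: \<gamma>_def \<mu>8_def exec_step_size M7)
  qed
  have "matrix_at \<mu>9 0 = (1 - \<gamma>) *\<^sub>R X + \<gamma> *\<^sub>R V"
    by (simp add: \<mu>9_def exec_update M8 \<gamma>_def)
  moreover have "case rule of
      Line_Search \<Rightarrow> is_arg_min (\<lambda>\<delta>. f ((1 - \<delta>) *\<^sub>R X + \<delta> *\<^sub>R V)) (\<lambda>\<delta>. \<delta> \<in> {0..1}) \<gamma>
    | Predefined \<Rightarrow> \<gamma> = step_param s \<beta> \<alpha>"
    using S by (simp add: \<gamma> correct_subroutines_def split: step_rule.split)
  ultimately show "fw_step f g R s \<beta> (step_param s \<beta> \<alpha>) rule (matrix_at \<mu> 0)
      (matrix_at (exec s S (iteration s rule) \<mu>) 0)"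
    using Z V unfolding fw_step_def iter X_def[symmetric] by blast
  show "exec s S (iteration s rule) \<mu> (Scalar l) = \<mu> (Scalar l)" if "l < 3"
    using that S7[OF that] unfolding iter \<mu>9_def
    by (subst exec_update(2)) (auto simp: \<mu>8_def exec_step_size)
qed

lemma machine_run_fw_run:
  fixes mem :: "nat \<Rightarrow> ('m::finite, 'n::finite) memory"
  assumes S: "correct_subroutines f g s S" and s: "0 < s" "s \<le> num_sv TYPE(real^'n^'m)"
    and pos: "0 < R" "0 < \<beta>" "0 < \<alpha>"
    and init: "X1 \<in> nuclear_ball R" "initial_memory R \<beta> \<alpha> X1 (mem 1)"
    and run: "machine_run (iteration s) s S rule mem"
  shows "fw_run f g R s \<beta> \<alpha> rule (\<lambda>t. matrix_at (mem t) 0)"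
proof -
  have next_mem: "mem (Suc t) = exec s S (iteration s (rule t)) (mem t)" if "1 \<le> t" for t
    using run that by (simp add: machine_run_def)
  \<comment> \<open>Apart from the iterate in register 0, these three cells are all that one
    iteration passes on to the next: every other cell is written before it is read.\<close>
  have par: "mem t (Scalar 0) = R \<and> mem t (Scalar 1) = \<beta> \<and> mem t (Scalar 2) = \<alpha>" if "1 \<le> t" for t
    using that
  proof (induction t rule: nat_induct_at_least)
    case base
    then show ?case using init(2) by (simp add: initial_memory_def)
  next
    case (Suc t)
    then have "mem (Suc t) (Scalar l) = mem t (Scalar l)" if "l < 3" for l
      unfolding next_mem[OF Suc.hyps(1)] using exec_iteration(2)[OF S s] pos that by blast
    then show ?case using Suc by simp
  qed
  have "fw_step f g R s \<beta> (step_param s \<beta> \<alpha>) (rule t) (matrix_at (mem t) 0) (matrix_at (mem (Suc t)) 0)"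
    if "1 \<le> t" for t
    unfolding next_mem[OF that] using par[OF that] pos by (intro exec_iteration(1)[OF S s]) auto
  then show ?thesis using init by (simp add: fw_run_def initial_memory_def)
qed

text \<open>The program is chosen before the objective and the constants, so it can depend only on
  \<open>s\<close>, the dimensions and the step rule. The rate is claimed for every run of the
  algorithm, and the machine runs are then shown to be such runs.\<close>

theorem corollary2:
  fixes s :: nat
  assumes "0 < s" and "s < min CARD('m::finite) CARD('n::finite)"
  shows "\<exists>P :: step_rule \<Rightarrow> ('m, 'n) prog.
    \<forall>(f :: real^'n^'m \<Rightarrow> real) g R \<beta>1 \<alpha>2.
      convex_on UNIV f \<and> (\<forall>X. GDERIV f X :> g X) \<and> continuous_on UNIV g \<and>
      0 < R \<and>
      0 < \<beta>1 \<and> nuclear_lipschitz g R \<beta>1 \<and>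
      0 < \<alpha>2 \<and> quadratic_growth f R \<alpha>2 \<and>
      (\<forall>Xs\<in>minimizers f R. rank Xs \<le> s \<and> nuclear_norm Xs = R) \<and>
      step_param s \<beta>1 \<alpha>2 \<in> {0..1} \<longrightarrow>
        (\<forall>rule X. fw_run f g R s \<beta>1 \<alpha>2 rule X \<longrightarrow> linear_iteration_bound f R s \<beta>1 \<alpha>2 X) \<and>
        (\<forall>S rule X1 mem.
           correct_subroutines f g s S \<and>
           X1 \<in> nuclear_ball R \<and> initial_memory R \<beta>1 \<alpha>2 X1 (mem 1) \<and>
           machine_run P s S rule mem \<longrightarrow>
             fw_run f g R s \<beta>1 \<alpha>2 rule (\<lambda>t. matrix_at (mem t) 0) \<and>
             linear_iteration_bound f R s \<beta>1 \<alpha>2 (\<lambda>t. matrix_at (mem t) 0) \<and>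
             (\<forall>t\<ge>1. dominated_by_two_svds s S (rule t) (P (rule t)) (mem t)))"
proof (rule exI[of _ "iteration s"], intro allI impI, elim conjE)
  fix f :: "real^'n^'m \<Rightarrow> real" and g R \<beta>1 \<alpha>2
  assume *: "convex_on UNIV f" "\<forall>X. GDERIV f X :> g X" "0 < R" "0 < \<beta>1" "nuclear_lipschitz g R \<beta>1"
    "0 < \<alpha>2" "quadratic_growth f R \<alpha>2" "\<forall>Xs\<in>minimizers f R. rank Xs \<le> s \<and> nuclear_norm Xs = R"
    "step_param s \<beta>1 \<alpha>2 \<in> {0..1}"
  interpret low_rank_problem f g R s \<beta>1 \<alpha>2
    by unfold_locales (use * assms in auto)
  have s: "s \<le> num_sv TYPE(real^'n^'m)" using assms by (simp add: num_sv_def)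
  show "(\<forall>rule X. fw_run f g R s \<beta>1 \<alpha>2 rule X \<longrightarrow> linear_iteration_bound f R s \<beta>1 \<alpha>2 X) \<and>
        (\<forall>S rule X1 mem.
           correct_subroutines f g s S \<and>
           X1 \<in> nuclear_ball R \<and> initial_memory R \<beta>1 \<alpha>2 X1 (mem 1) \<and>
           machine_run (iteration s) s S rule mem \<longrightarrow>
             fw_run f g R s \<beta>1 \<alpha>2 rule (\<lambda>t. matrix_at (mem t) 0) \<and>
             linear_iteration_bound f R s \<beta>1 \<alpha>2 (\<lambda>t. matrix_at (mem t) 0) \<and>
             (\<forall>t\<ge>1. dominated_by_two_svds s S (rule t) (iteration s (rule t)) (mem t)))"
    using run_linear_convergence machine_run_fw_run[OF _ s_pos s R_pos \<beta>_pos \<alpha>_pos]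
      iteration_dominated[OF s_pos] by blast
qed

end
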